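(* Let $V$ be an optimal prefix-free machine, and for real $T>0$ let $\Theta_V(T)=\sum_{s\in\{0,1\}^*,\,H_V(s)<|s|}2^{-|s|/T}$. For every $T\in(0,1)$, if $\Theta_V(T)$ is computable, then $T$ is weakly Chaitin $T$-random and $T$-compressible.
   Context: $\{0,1\}^*$ is the set of finite binary strings; $|s|$ is the length of $s$. A prefix-free machine is a partial recursive function $C:\{0,1\}^*\to\{0,1\}^*$ whose domain is prefix-free. $H_C(s)=\min\{|p| : C(p)=s\}$ (possibly $\infty$). A prefix-free machine $U$ is optimal if for every prefix-free machine $C$ there is $d\in\mathbb{N}$ such that for every $p\in\mathrm{Dom}\,C$ there is $q\in\mathrm{Dom}\,U$ with $U(q)=C(p)$ and $|q|\le|p|+d$. A particular optimal prefix-free machine $U$ is fixed and $H(s):=H_U(s)$. For a real $\alpha$ and $n\ge1$, $\alpha\restriction n$ denotes the first $n$ bits of the base-two expansion of $\alpha-\lfloor\alpha\rfloor$ (the expansion with infinitely many zeros). A real $\alpha$ is computable if there is a total recursive $f:\mathbb{N}^+\to\mathbb{Q}$ with $|\alpha-f(n)|<1/n$ for all $n$. For $T\in(0,1]$, $\alpha$ is weakly Chaitin $T$-random if there is $c\in\mathbb{N}$ with $Tn-c\le H(\alpha\restriction n)$ for all $n\in\mathbb{N}^+$; $\alpha$ is $T$-compressible if $\limsup_{n\to\infty}H(\alpha\restriction n)/n\le T$. *)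

theory Defs
  imports "HOL-Analysis.Analysis" "HOL-Library.Sublist" "HOL-Library.Extended_Real"
begin

datatype recf = Zero | Succ | Proj nat | Comp recf "recf list" | Prim recf recf | Mn recf

inductive eval_recf :: "recf \<Rightarrow> nat list \<Rightarrow> nat \<Rightarrow> bool" where
  ev_zero: "eval_recf Zero xs 0"
| ev_succ: "eval_recf Succ (x # xs) (Suc x)"
| ev_proj: "i < length xs \<Longrightarrow> eval_recf (Proj i) xs (xs ! i)"
| ev_comp: "list_all2 (\<lambda>g y. eval_recf g xs y) gs ys \<Longrightarrow> eval_recf f ys z
            \<Longrightarrow> eval_recf (Comp f gs) xs z"
| ev_prim0: "eval_recf f xs y \<Longrightarrow> eval_recf (Prim f g) (0 # xs) y"
| ev_primS: "eval_recf (Prim f g) (n # xs) y \<Longrightarrow> eval_recf g (y # n # xs) z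
            \<Longrightarrow> eval_recf (Prim f g) (Suc n # xs) z"
| ev_mn: "eval_recf f (n # xs) 0 \<Longrightarrow> (\<forall>m<n. \<exists>y. eval_recf f (m # xs) y \<and> y \<noteq> 0)
            \<Longrightarrow> eval_recf (Mn f) xs n"

definition partial_recursive :: "(nat \<Rightarrow> nat option) \<Rightarrow> bool" where
  "partial_recursive \<phi> \<longleftrightarrow> (\<exists>f. \<forall>x y. eval_recf f [x] y \<longleftrightarrow> \<phi> x = Some y)"

definition total_recursive :: "(nat \<Rightarrow> nat) \<Rightarrow> bool" where
  "total_recursive a \<longleftrightarrow> partial_recursive (\<lambda>n. Some (a n))"

text \<open>Binary strings are bool list (True = 1). Standard bijection
  with the naturals: the string s is sent to (value of the binary numeral 1s) - 1.\<close>
definition str_code :: "bool list \<Rightarrow> nat" where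
  "str_code s = (\<Sum>i<length s. (if s ! i then 1 else 0) * 2 ^ (length s - 1 - i)) + 2 ^ length s - 1"

definition partial_recursive_str :: "(bool list \<Rightarrow> bool list option) \<Rightarrow> bool" where
  "partial_recursive_str C \<longleftrightarrow>
     (\<exists>\<phi>. partial_recursive \<phi> \<and> (\<forall>p. \<phi> (str_code p) = map_option str_code (C p)))"

definition prefix_free :: "bool list set \<Rightarrow> bool" where
  "prefix_free A \<longleftrightarrow> (\<forall>p\<in>A. \<forall>q\<in>A. prefix p q \<longrightarrow> p = q)"

definition prefix_free_machine :: "(bool list \<Rightarrow> bool list option) \<Rightarrow> bool" where
  "prefix_free_machine C \<longleftrightarrow> partial_recursive_str C \<and> prefix_free (dom C)"

definition Hc :: "(bool list \<Rightarrow> bool list option) \<Rightarrow> bool list \<Rightarrow> enat" where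
  "Hc C s = (INF p \<in> {p. C p = Some s}. enat (length p))"

definition optimal_machine :: "(bool list \<Rightarrow> bool list option) \<Rightarrow> bool" where
  "optimal_machine U \<longleftrightarrow> prefix_free_machine U \<and>
     (\<forall>C. prefix_free_machine C \<longrightarrow>
        (\<exists>d::nat. \<forall>p \<in> dom C. \<exists>q \<in> dom U. U q = C p \<and> length q \<le> length p + d))"

text \<open>First n bits of the base-two expansion (with infinitely many zeros) of
  the fractional part of x; bit i (i \<ge> 1) is floor(2^i frac x) mod 2.\<close>
definition prefix_bits :: "real \<Rightarrow> nat \<Rightarrow> bool list" where
  "prefix_bits x n = map (\<lambda>i. odd \<lfloor>2 ^ (i + 1) * frac x\<rfloor>) [0..<n]"

text \<open>Computable real: total recursive approximation by rationals;
  the rational f(n) is represented as (a n - b n)/(c n + 1).\<close>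
definition computable_real :: "real \<Rightarrow> bool" where
  "computable_real x \<longleftrightarrow> (\<exists>a b c. total_recursive a \<and> total_recursive b \<and> total_recursive c \<and>
     (\<forall>n\<ge>1. \<bar>x - (real (a n) - real (b n)) / real (c n + 1)\<bar> < 1 / real n))"

definition weakly_Chaitin_random :: "(bool list \<Rightarrow> bool list option) \<Rightarrow> real \<Rightarrow> real \<Rightarrow> bool" where
  "weakly_Chaitin_random U T \<alpha> \<longleftrightarrow>
     (\<exists>c::nat. \<forall>n\<ge>1. ereal (T * real n - real c) \<le> ereal_of_enat (Hc U (prefix_bits \<alpha> n)))"

definition compressible :: "(bool list \<Rightarrow> bool list option) \<Rightarrow> real \<Rightarrow> real \<Rightarrow> bool" where
  "compressible U T \<alpha> \<longleftrightarrow>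
     limsup (\<lambda>n. ereal_of_enat (Hc U (prefix_bits \<alpha> n)) / ereal (real n)) \<le> ereal T"

definition Theta :: "(bool list \<Rightarrow> bool list option) \<Rightarrow> real \<Rightarrow> real" where
  "Theta V T = (\<Sum>\<^sub>\<infinity> s \<in> {s. Hc V s < enat (length s)}. 2 powr (- real (length s) / T))"

end

theory Submission
  imports Defs
begin

text \<open>
  Let \<open>A\<close> be the recursively enumerable set of strings with \<open>H\<^sub>V(s) < |s|\<close>, let \<open>A\<^sub>k\<close> be the part of
  it enumerated by stage \<open>k\<close>, and let \<open>Z\<^sub>k(t)\<close> be the sum of \<open>2\<^bsup>-|s|/t\<^esup>\<close> over \<open>A\<^sub>k\<close>, which increases to
  \<open>\<Theta>\<^sub>V(t)\<close>. By Kraft's inequality the sum of \<open>2\<^bsup>-|s|\<^esup>\<close> over \<open>A\<close> is at most \<open>1/2\<close>.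

  Randomness: given the first \<open>n\<close> bits of \<open>T\<close>, search for a stage \<open>k\<close> with \<open>Z\<^sub>k(t)\<close> above
  \<open>\<Theta>\<^sub>V(T) - O(2\<^bsup>-n\<^esup>)\<close>, where \<open>T < t \<le> T + 2\<^bsup>-n\<^esup>\<close>. As \<open>Z\<^sub>k\<close> is Lipschitz near \<open>T\<close> uniformly in \<open>k\<close>,
  every element of \<open>A\<close> outside \<open>A\<^sub>k\<close> has weight \<open>O(2\<^bsup>-n\<^esup>)\<close>, hence length at least \<open>T n - O(1)\<close>. A slightly
  shorter string outside \<open>A\<^sub>k\<close> is therefore outside \<open>A\<close>, and it has complexity at least
  \<open>T n - O(1)\<close> although it was computed from those \<open>n\<close> bits.

  Compressibility: once a stage with \<open>\<Theta>\<^sub>V(T) - Z\<^sub>k(T) \<le> 2\<^bsup>-n\<^esup>\<close> is known, solving \<open>Z\<^sub>k(t) = \<Theta>\<^sub>V(T)\<close>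
  approximately gives \<open>T\<close> up to \<open>O(2\<^bsup>-n\<^esup>)\<close>. For rational \<open>T' \<ge> T\<close>, counting each enumerated string as
  \<open>1\<close> if its length is at most \<open>T' n\<close> and as about \<open>2\<^bsup>n-|s|/T'\<^esup>\<close> otherwise gives a total of at most
  \<open>2\<^bsup>T'n\<^esup>\<close>, and any stage at which this total is within \<open>1\<close> of its limit will do. So about \<open>T' n\<close> bits
  suffice to describe the first \<open>n\<close> bits of \<open>T\<close>.
\<close>

section \<open>Recursive functions of an environment\<close>

text \<open>Functions of several arguments are functions of an environment \<open>e :: nat \<Rightarrow> nat\<close>, of which only
  a finite initial part is read; binding a variable shifts the environment by one.\<close>

definition rec_env :: "((nat \<Rightarrow> nat) \<Rightarrow> nat) \<Rightarrow> bool" where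
  "rec_env F \<longleftrightarrow> (\<exists>r k. \<forall>k'\<ge>k. \<forall>e y. eval_recf r (map e [0..<k']) y \<longleftrightarrow> y = F e)"

definition dec_env :: "((nat \<Rightarrow> nat) \<Rightarrow> bool) \<Rightarrow> bool" where
  "dec_env P \<longleftrightarrow> rec_env (\<lambda>e. if P e then 1 else 0)"

inductive_simps eval_Zero: "eval_recf Zero xs y"
inductive_simps eval_Succ: "eval_recf Succ xs y"
inductive_simps eval_Proj: "eval_recf (Proj i) xs y"
inductive_simps eval_Comp: "eval_recf (Comp f gs) xs y"
inductive_simps eval_Prim_0: "eval_recf (Prim f g) (0 # xs) y"
inductive_simps eval_Prim_Suc: "eval_recf (Prim f g) (Suc n # xs) y"
inductive_simps eval_Mn: "eval_recf (Mn f) xs y"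

lemma rec_envI:
  assumes "\<And>k' e y. k \<le> k' \<Longrightarrow> eval_recf r (map e [0..<k']) y \<longleftrightarrow> y = F e"
  shows "rec_env F"
  using assms unfolding rec_env_def by blast

lemma rec_env_var: "rec_env (\<lambda>e. e i)"
  by (rule rec_envI[of "Suc i" "Proj i"]) (auto simp: eval_Proj)

lemma list_all2_eval_map:
  assumes "\<And>i y. i < k \<Longrightarrow> eval_recf (rs i) xs y \<longleftrightarrow> y = v i"
  shows "list_all2 (\<lambda>g y. eval_recf g xs y) (map rs [0..<k]) ys \<longleftrightarrow> ys = map v [0..<k]"
proof -
  have "list_all2 (\<lambda>g y. eval_recf g xs y) (map rs [0..<k]) ys \<longleftrightarrow>
      length ys = k \<and> (\<forall>i<k. ys ! i = v i)"
    using assms by (auto simp: list_all2_conv_all_nth)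
  also have "\<dots> \<longleftrightarrow> ys = map v [0..<k]"
    by (auto intro: nth_equalityI)
  finally show ?thesis .
qed

text \<open>\<open>r\<close> reads only the variables below \<open>k\<close>, so finitely many of
  the substituted functions matter, and the sum of their bounds serves them all.\<close>

lemma rec_env_subst:
  assumes F: "rec_env F" and s: "\<And>i. rec_env (\<sigma> i)"
  shows "rec_env (\<lambda>e. F (\<lambda>i. \<sigma> i e))"
proof -
  obtain r k where r: "\<forall>k'\<ge>k. \<forall>e y. eval_recf r (map e [0..<k']) y \<longleftrightarrow> y = F e"
    using F unfolding rec_env_def by blast
  have "\<forall>i. \<exists>ri ki. \<forall>k'\<ge>ki. \<forall>e y. eval_recf ri (map e [0..<k']) y \<longleftrightarrow> y = \<sigma> i e"
    using s unfolding rec_env_def by blast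
  then obtain rs ks where
    rs: "\<And>i k' e y. ks i \<le> k' \<Longrightarrow> eval_recf (rs i) (map e [0..<k']) y \<longleftrightarrow> y = \<sigma> i e"
    by metis
  show ?thesis
  proof (rule rec_envI[of "\<Sum>i<k. ks i" "Comp r (map rs [0..<k])"])
    fix k' e y assume k': "(\<Sum>i<k. ks i) \<le> k'"
    have "ks i \<le> k'" if "i < k" for i
      using member_le_sum[of i "{..<k}" ks] that k' by simp
    then have "list_all2 (\<lambda>g y. eval_recf g (map e [0..<k']) y) (map rs [0..<k]) ys
        \<longleftrightarrow> ys = map (\<lambda>i. \<sigma> i e) [0..<k]" for ys
      by (intro list_all2_eval_map) (simp add: rs)
    then show "eval_recf (Comp r (map rs [0..<k])) (map e [0..<k']) y \<longleftrightarrow> y = F (\<lambda>i. \<sigma> i e)"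
      by (simp add: eval_Comp r)
  qed
qed

lemma rec_env_shift: "rec_env F \<Longrightarrow> rec_env (\<lambda>e. F (\<lambda>i. e (Suc i)))"
  using rec_env_subst[of F "\<lambda>i e. e (Suc i)"] rec_env_var by simp

text \<open>Weakening beneath a binder: variable \<open>0\<close> stays and a new variable is
  inserted right after it. This serves conditions on one bound variable that are put under a second
  one.\<close>

lemma rec_env_skip:
  assumes "rec_env F"
  shows "rec_env (\<lambda>e. F (case_nat (e 0) (\<lambda>i. e (Suc (Suc i)))))"
proof -
  have "rec_env (\<lambda>e. case_nat (e 0) (\<lambda>i. e (Suc (Suc i))) i)" for i
    by (cases i) (simp_all add: rec_env_var)
  from rec_env_subst[of F "\<lambda>i e. case_nat (e 0) (\<lambda>i. e (Suc (Suc i))) i", OF assms this] show ?thesis by simp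
qed

text \<open>Lets \<open>f\<close> be analysed on a bare variable, so that \<open>G\<close> need not
  be shifted under the binders inside \<open>f\<close>.\<close>

lemma rec_env_comp1:
  assumes "rec_env (\<lambda>e. f (e 0))" "rec_env G"
  shows "rec_env (\<lambda>e. f (G e))"
  using rec_env_subst[OF assms(1), of "\<lambda>_. G"] assms(2) by simp

lemma rec_env_comp2:
  assumes f: "rec_env (\<lambda>e. f (e 0) (e (Suc 0)))" and "rec_env G" "rec_env H"
  shows "rec_env (\<lambda>e. f (G e) (H e))"
proof -
  have "rec_env (case_nat G (\<lambda>_. H) i)" for i
    using assms(2-) by (cases i) simp_all
  from rec_env_subst[of _ "case_nat G (\<lambda>_. H)", OF f this] show ?thesis by simp
qed

lemma rec_env_comp3:
  assumes f: "rec_env (\<lambda>e. f (e 0) (e (Suc 0)) (e (Suc (Suc 0))))"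
    and "rec_env G" "rec_env H" "rec_env I"
  shows "rec_env (\<lambda>e. f (G e) (H e) (I e))"
proof -
  have "rec_env (case_nat G (case_nat H (\<lambda>_. I)) i)" for i
    using assms(2-) by (simp split: nat.split)
  from rec_env_subst[of _ "case_nat G (case_nat H (\<lambda>_. I))", OF f this] show ?thesis by simp
qed

lemma rec_env_comp4:
  assumes f: "rec_env (\<lambda>e. f (e 0) (e (Suc 0)) (e (Suc (Suc 0))) (e (Suc (Suc (Suc 0)))))"
    and "rec_env G" "rec_env H" "rec_env I" "rec_env J"
  shows "rec_env (\<lambda>e. f (G e) (H e) (I e) (J e))"
proof -
  have "rec_env (case_nat G (case_nat H (case_nat I (\<lambda>_. J))) i)" for i
    using assms(2-) by (simp split: nat.split)
  from rec_env_subst[of _ "case_nat G (case_nat H (case_nat I (\<lambda>_. J)))", OF f this] show ?thesis by simp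
qed

lemma rec_env_Suc: "rec_env G \<Longrightarrow> rec_env (\<lambda>e. Suc (G e))"
proof (rule rec_env_comp1[of Suc], rule rec_envI[of 1 Succ])
  fix k' :: nat and e y assume "1 \<le> k'"
  then show "eval_recf Succ (map e [0..<k']) y \<longleftrightarrow> y = Suc (e 0)"
    by (cases k') (auto simp: eval_Succ map_upt_Suc simp del: upt_Suc)
qed

lemma rec_env_const: "rec_env (\<lambda>_. n)"
proof (induction n)
  case 0
  show ?case by (rule rec_envI[of 0 Zero]) (auto simp: eval_Zero)
next
  case (Suc n)
  then show ?case by (rule rec_env_Suc)
qed

lemma rec_env_total_recursive:
  assumes "total_recursive f" "rec_env G"
  shows "rec_env (\<lambda>e. f (G e))"
proof (rule rec_env_comp1[OF _ assms(2)])
  obtain r where r: "\<And>x y. eval_recf r [x] y \<longleftrightarrow> f x = y"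
    using assms(1) unfolding total_recursive_def partial_recursive_def by auto
  show "rec_env (\<lambda>e. f (e 0))"
  proof (rule rec_envI[of 1 "Comp r (map Proj [0..<1])"])
    fix k' :: nat and e y assume "1 \<le> k'"
    then have "list_all2 (\<lambda>g y. eval_recf g (map e [0..<k']) y) (map Proj [0..<1]) ys
        \<longleftrightarrow> ys = map e [0..<1]" for ys
      by (intro list_all2_eval_map) (auto simp: eval_Proj)
    then show "eval_recf (Comp r (map Proj [0..<1])) (map e [0..<k']) y \<longleftrightarrow> y = f (e 0)"
      by (auto simp: eval_Comp r)
  qed
qed

text \<open>The step function finds the previous value in variable \<open>0\<close>, the counter in
  variable \<open>1\<close> and the original environment from variable \<open>2\<close> on, which is
  the argument order of \<open>Prim\<close>.\<close>

lemma rec_env_primrec: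
  assumes G: "rec_env G" and h: "rec_env (\<lambda>e. h (e 0) (e (Suc 0)) (\<lambda>i. e (Suc (Suc i))))"
    and N: "rec_env N"
  shows "rec_env (\<lambda>e. rec_nat (G e) (\<lambda>i r. h r i e) (N e))"
proof -
  obtain rG kG where rG: "\<forall>k'\<ge>kG. \<forall>e y. eval_recf rG (map e [0..<k']) y \<longleftrightarrow> y = G e"
    using G unfolding rec_env_def by blast
  obtain rH kH where rH: "\<forall>k'\<ge>kH. \<forall>e y. eval_recf rH (map e [0..<k']) y \<longleftrightarrow>
      y = h (e 0) (e (Suc 0)) (\<lambda>i. e (Suc (Suc i)))"
    using h unfolding rec_env_def by blast
  obtain rN kN where rN: "\<forall>k'\<ge>kN. \<forall>e y. eval_recf rN (map e [0..<k']) y \<longleftrightarrow> y = N e"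
    using N unfolding rec_env_def by blast
  define K where "K = kG + kH + kN"
  have H: "eval_recf rH (a # n # map e [0..<K]) y \<longleftrightarrow> y = h a n e" for a n e y
    using rH[rule_format, of "Suc (Suc K)" "case_nat a (case_nat n e)" y]
    by (simp add: K_def map_upt_Suc del: upt_Suc)
  have P: "eval_recf (Prim rG rH) (n # map e [0..<K]) y \<longleftrightarrow> y = rec_nat (G e) (\<lambda>i r. h r i e) n"
    for n e y
  proof (induction n arbitrary: y)
    case 0
    show ?case by (simp add: eval_Prim_0 rG K_def)
  next
    case (Suc n)
    then show ?case by (simp add: eval_Prim_Suc H)
  qed
  show ?thesis
  \<comment> \<open>The projections cut the argument list down to length exactly \<open>K\<close>,
    the length for which \<open>P\<close> describes the recursion.\<close>
  proof (rule rec_envI[of K "Comp (Prim rG rH) (rN # map Proj [0..<K])"])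
    fix k' e y assume k': "K \<le> k'"
    have "list_all2 (\<lambda>g y. eval_recf g (map e [0..<k']) y) (map Proj [0..<K]) ys
        \<longleftrightarrow> ys = map e [0..<K]" for ys
      using k' by (intro list_all2_eval_map) (auto simp: eval_Proj)
    moreover have "eval_recf rN (map e [0..<k']) y \<longleftrightarrow> y = N e" for y
      using k' by (intro rN[rule_format]) (simp add: K_def)
    ultimately show "eval_recf (Comp (Prim rG rH) (rN # map Proj [0..<K])) (map e [0..<k']) y
        \<longleftrightarrow> y = rec_nat (G e) (\<lambda>i r. h r i e) (N e)"
      by (auto simp: eval_Comp list_all2_Cons1 P)
  qed
qed

section \<open>Arithmetic operations and finite sums\<close>

lemma rec_env_add: 
  assumes "rec_env F" "rec_env G" shows "rec_env (\<lambda>e. F e + G e)"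
proof -
  have "rec_nat a (\<lambda>i r. Suc r) b = a + b" for a b :: nat by (induction b) auto
  then show ?thesis
    using rec_env_primrec[OF assms(1) _ assms(2), of "\<lambda>r i e. Suc r"]
    by (simp add: rec_env_Suc rec_env_var)
qed

lemma rec_env_mult:
  assumes "rec_env F" "rec_env G" shows "rec_env (\<lambda>e. F e * G e)"
proof -
  have "rec_nat 0 (\<lambda>i r. r + a) b = a * b" for a b :: nat by (induction b) auto
  moreover have "rec_env (\<lambda>e. e 0 + F (\<lambda>i. e (Suc (Suc i))))"
    by (intro rec_env_add rec_env_var rec_env_shift[of "\<lambda>e. F (\<lambda>i. e (Suc i))"]
        rec_env_shift[of F] assms)
  ultimately show ?thesis
    using rec_env_primrec[OF rec_env_const[of 0] _ assms(2), of "\<lambda>r i e. r + F e"] by simp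
qed

lemma rec_env_power:
  assumes "rec_env F" "rec_env G" shows "rec_env (\<lambda>e. F e ^ G e)"
proof -
  have "rec_nat 1 (\<lambda>i r. r * a) b = a ^ b" for a b :: nat by (induction b) auto
  moreover have "rec_env (\<lambda>e. e 0 * F (\<lambda>i. e (Suc (Suc i))))"
    by (intro rec_env_mult rec_env_var rec_env_shift[of "\<lambda>e. F (\<lambda>i. e (Suc i))"]
        rec_env_shift[of F] assms)
  ultimately show ?thesis
    using rec_env_primrec[OF rec_env_const[of 1] _ assms(2), of "\<lambda>r i e. r * F e"] by simp
qed

lemma rec_env_diff:
  assumes "rec_env F" "rec_env G" shows "rec_env (\<lambda>e. F e - G e)"
proof -
  have pred: "rec_env (\<lambda>e. e 0 - 1)"
  proof -
    have "rec_nat 0 (\<lambda>i r. i) b = b - 1" for b :: nat by (cases b) auto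
    then show ?thesis
      using rec_env_primrec[OF rec_env_const[of 0] _ rec_env_var[of 0], of "\<lambda>r i e. i"]
      by (simp add: rec_env_var)
  qed
  have "rec_nat a (\<lambda>i r. r - 1) b = a - b" for a b :: nat by (induction b) auto
  then show ?thesis
    using rec_env_primrec[OF assms(1) _ assms(2), of "\<lambda>r i e. r - 1"] pred by simp
qed

lemma rec_env_sum:
  assumes "rec_env B" "rec_env (\<lambda>e. f (e 0) (\<lambda>i. e (Suc i)))"
  shows "rec_env (\<lambda>e. \<Sum>i<B e. f i e)"
proof -
  have "rec_nat 0 (\<lambda>i r. r + g i) b = (\<Sum>i<b. g i)" for b :: nat and g :: "nat \<Rightarrow> nat"
    by (induction b) auto
  moreover have "rec_env (\<lambda>e. e 0 + f (e (Suc 0)) (\<lambda>i. e (Suc (Suc i))))"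
    by (intro rec_env_add rec_env_var rec_env_shift[OF assms(2)])
  ultimately show ?thesis
    using rec_env_primrec[OF rec_env_const[of 0] _ assms(1), of "\<lambda>r i e. r + f i e"] by simp
qed

section \<open>Decidable predicates, bounded quantifiers and case distinction\<close>

lemma dec_env_zero: assumes "rec_env F" shows "dec_env (\<lambda>e. F e = 0)"
proof -
  have "(if F e = 0 then 1 else 0) = 1 - F e" for e by auto
  then show ?thesis unfolding dec_env_def
    by (simp only:) (intro rec_env_diff rec_env_const assms)
qed

lemma dec_env_not: assumes "dec_env P" shows "dec_env (\<lambda>e. \<not> P e)"
proof -
  have "(\<lambda>e. \<not> P e) = (\<lambda>e. (if P e then 1 else 0 :: nat) = 0)" by auto
  then show ?thesis using dec_env_zero[OF assms[unfolded dec_env_def]] by (simp only:)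
qed

lemma dec_env_conj: assumes "dec_env P" "dec_env Q" shows "dec_env (\<lambda>e. P e \<and> Q e)"
proof -
  have "(\<lambda>e. if P e \<and> Q e then 1 else 0) = (\<lambda>e. (if P e then 1 else 0) * (if Q e then 1 else 0 :: nat))"
    by auto
  then show ?thesis
    using rec_env_mult[OF assms[unfolded dec_env_def]] unfolding dec_env_def by (simp only:)
qed

lemma dec_env_disj: assumes "dec_env P" "dec_env Q" shows "dec_env (\<lambda>e. P e \<or> Q e)"
  using dec_env_not[OF dec_env_conj[OF assms[THEN dec_env_not]]] by simp

lemma dec_env_le: assumes "rec_env F" "rec_env G" shows "dec_env (\<lambda>e. F e \<le> G e)"
  using dec_env_zero[OF rec_env_diff[OF assms]] by simp

lemma dec_env_less: assumes "rec_env F" "rec_env G" shows "dec_env (\<lambda>e. F e < G e)"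
  using dec_env_not[OF dec_env_le[OF assms(2,1)]] by (simp add: not_le)

lemma dec_env_eq: assumes "rec_env F" "rec_env G" shows "dec_env (\<lambda>e. F e = G e)"
  using dec_env_conj[OF dec_env_le[OF assms] dec_env_le[OF assms(2,1)]]
  by (simp add: eq_iff)

lemma dec_env_bex:
  assumes "rec_env B" "dec_env (\<lambda>e. P (e 0) (\<lambda>i. e (Suc i)))"
  shows "dec_env (\<lambda>e. \<exists>i<B e. P i e)"
proof -
  have "(\<exists>i<B e. P i e) \<longleftrightarrow> \<not> (\<Sum>i<B e. if P i e then 1 else 0::nat) = 0" for e
    by (auto simp: sum_eq_0_iff)
  then show ?thesis
    by (simp only:) (intro dec_env_not dec_env_zero rec_env_sum assms[unfolded dec_env_def])
qed

lemma dec_env_ball: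
  assumes "rec_env B" "dec_env (\<lambda>e. P (e 0) (\<lambda>i. e (Suc i)))"
  shows "dec_env (\<lambda>e. \<forall>i<B e. P i e)"
  using dec_env_not[OF dec_env_bex[OF assms(1) dec_env_not[OF assms(2)]]] by simp

lemma rec_env_if:
  assumes "dec_env P" "rec_env F" "rec_env G"
  shows "rec_env (\<lambda>e. if P e then F e else G e)"
proof -
  have "(if P e then F e else G e) =
      (if P e then 1 else 0) * F e + (if \<not> P e then 1 else 0) * G e" for e by simp
  then show ?thesis
    by (simp only:) (intro rec_env_add rec_env_mult assms dec_env_not[unfolded dec_env_def]
      assms(1)[unfolded dec_env_def])
qed

text \<open>The quotient counts the positive multiples of \<open>b\<close> that do not exceed
  \<open>a\<close>; for \<open>b > 0\<close> there are at most \<open>a\<close> of them.\<close>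

lemma rec_env_div:
  assumes "rec_env F" "rec_env G" shows "rec_env (\<lambda>e. F e div G e)"
proof -
  have "a div b = (if b = 0 then 0 else \<Sum>i<a. if Suc i * b \<le> a then 1 else 0)" for a b :: nat
  proof (cases "b = 0")
    case False
    have "{i. i < a \<and> Suc i * b \<le> a} = {..<a div b}"
    proof -
      have "i < a \<and> Suc i * b \<le> a \<longleftrightarrow> i < a div b" for i
        using False less_eq_div_iff_mult_less_eq[of b "Suc i" a] div_le_dividend[of a b]
        by (auto simp: Suc_le_eq intro: less_le_trans)
      then show ?thesis by auto
    qed
    then show ?thesis using False by (simp add: sum.If_cases Int_def lessThan_def)
  qed simp
  then have "(\<lambda>e. F e div G e) =
      (\<lambda>e. (\<lambda>a b. if b = 0 then 0 else \<Sum>i<a. if Suc i * b \<le> a then 1 else 0) (F e) (G e))" by auto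
  moreover have "rec_env \<dots>"
    by (rule rec_env_comp2[OF _ assms])
       (intro rec_env_if dec_env_zero rec_env_sum dec_env_le rec_env_mult rec_env_Suc rec_env_var
         rec_env_const)
  ultimately show ?thesis by simp
qed

lemma rec_env_mod:
  assumes "rec_env F" "rec_env G" shows "rec_env (\<lambda>e. F e mod G e)"
  using rec_env_diff[OF assms(1) rec_env_mult[OF rec_env_div[OF assms] assms(2)]]
  by (simp add: minus_div_mult_eq_mod)

text \<open>A total form of minimisation: it counts the \<open>i < b\<close> with no witness up to
  \<open>i\<close>. This is the least witness if one lies below \<open>b\<close>, and
  \<open>b\<close> otherwise.\<close>

definition bounded_least :: "nat \<Rightarrow> (nat \<Rightarrow> bool) \<Rightarrow> nat" where
  "bounded_least b P = (\<Sum>i<b. if \<forall>j<Suc i. \<not> P j then 1 else 0)"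

lemma bounded_least_eq:
  assumes "\<exists>i<b. P i"
  shows "bounded_least b P = (LEAST i. P i)"
proof -
  let ?m = "LEAST i. P i"
  have m: "P ?m" "?m < b" 
    using assms LeastI[of P] Least_le[of P] by (blast, meson le_less_trans)
  have "i < b \<and> (\<forall>j<Suc i. \<not> P j) \<longleftrightarrow> i < ?m" for i
  proof
    assume "i < b \<and> (\<forall>j<Suc i. \<not> P j)"
    then show "i < ?m" using m(1) by (metis less_Suc_eq_le not_less)
  next
    assume i: "i < ?m"
    have "\<not> P j" if "j < Suc i" for j
      using that i by (intro not_less_Least) linarith
    then show "i < b \<and> (\<forall>j<Suc i. \<not> P j)"
      using less_trans[OF i m(2)] by blast
  qed
  then have "{i. i < b \<and> (\<forall>j<Suc i. \<not> P j)} = {..<?m}" by auto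
  then show ?thesis
    by (simp add: bounded_least_def sum.If_cases Int_def lessThan_def)
qed

lemma rec_env_bounded_least:
  assumes "rec_env B" "dec_env (\<lambda>e. P (e 0) (\<lambda>i. e (Suc i)))"
  shows "rec_env (\<lambda>e. bounded_least (B e) (\<lambda>i. P i e))"
  unfolding bounded_least_def
proof (intro rec_env_sum assms rec_env_if rec_env_const dec_env_ball dec_env_not rec_env_Suc
    rec_env_var)
  show "dec_env (\<lambda>e. P (e 0) (\<lambda>i. e (Suc (Suc i))))"
    using rec_env_skip[OF assms(2)[unfolded dec_env_def]] by (simp add: dec_env_def)
qed

lemmas rec_env_intros =
  rec_env_var rec_env_const rec_env_Suc rec_env_add rec_env_mult rec_env_power rec_env_diff
  rec_env_div rec_env_mod rec_env_sum rec_env_if rec_env_bounded_least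
  dec_env_not dec_env_conj dec_env_disj dec_env_le dec_env_less dec_env_eq dec_env_bex dec_env_ball

section \<open>Step-bounded evaluation\<close>

text \<open>The value \<open>0\<close> means that no result has been found within the bound \<open>t\<close>, and \<open>Suc y\<close> that the
  result is \<open>y\<close>.\<close>

fun stage :: "recf \<Rightarrow> nat \<Rightarrow> nat list \<Rightarrow> nat" where
  "stage Zero t xs = 1"
| "stage Succ t xs = (case xs of [] \<Rightarrow> 0 | x # _ \<Rightarrow> Suc (Suc x))"
| "stage (Proj i) t xs = (if i < length xs then Suc (xs ! i) else 0)"
| "stage (Comp f gs) t xs = (if \<exists>g\<in>set gs. stage g t xs = 0 then 0
     else stage f t (map (\<lambda>g. stage g t xs - 1) gs))"
| "stage (Prim f g) t xs = (case xs of [] \<Rightarrow> 0 | n # xs' \<Rightarrow>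
     rec_nat (stage f t xs') (\<lambda>i r. if r = 0 then 0 else stage g t ((r - 1) # i # xs')) n)"
| "stage (Mn f) t xs =
     (\<Sum>n<t. if stage f t (n # xs) = 1 \<and> (\<forall>m<n. 1 < stage f t (m # xs)) then Suc n else 0)"

lemma sum_unique_eq_Suc_iff:
  assumes "\<And>m n. P m \<Longrightarrow> P n \<Longrightarrow> m = n"
  shows "(\<Sum>n<t. if P n then Suc n else 0) = Suc y \<longleftrightarrow> y < t \<and> P y"
proof (cases "\<exists>n<t. P n")
  case True
  then obtain n where n: "n < t" "P n" by blast
  have "(\<Sum>m<t. if P m then Suc m else 0) = (\<Sum>m<t. if m = n then Suc n else 0)"
    using assms n by (intro sum.cong) auto
  then show ?thesis using n assms by auto
next
  case False
  then have "(\<Sum>n<t. if P n then Suc n else 0) = 0" by simp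
  with False show ?thesis by (metis nat.distinct(1))
qed

text \<open>At most one summand is nonzero, because a zero of \<open>f\<close> must be preceded by
  nonzero values only. The bound \<open>t\<close> acts here alone, as the range of the
  search.\<close>

lemma stage_Mn_eq_Suc_iff:
  "stage (Mn f) t xs = Suc y \<longleftrightarrow>
    y < t \<and> stage f t (y # xs) = 1 \<and> (\<forall>m<y. 1 < stage f t (m # xs))"
  unfolding stage.simps
  by (subst sum_unique_eq_Suc_iff) (metis less_irrefl linorder_neqE_nat, simp)

declare stage.simps(6) [simp del]

text \<open>A larger bound only widens the searches of \<open>Mn\<close>, and a search that has
  succeeded has a unique solution.\<close>

lemma stage_mono:
  "stage f t xs = Suc y \<Longrightarrow> t \<le> t' \<Longrightarrow> stage f t' xs = Suc y"
proof (induction f arbitrary: xs y)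
  case (Comp f gs)
  have nz: "stage g t xs \<noteq> 0" if "g \<in> set gs" for g
    using Comp.prems(1) that by (auto split: if_splits)
  have eq: "stage g t' xs = stage g t xs" if "g \<in> set gs" for g
    using Comp.IH(2)[OF that _ Comp.prems(2)] nz[OF that] by (metis not0_implies_Suc)
  have "stage f t (map (\<lambda>g. stage g t xs - 1) gs) = Suc y"
    using Comp.prems(1) by (simp split: if_splits)
  from Comp.IH(1)[OF this Comp.prems(2)] show ?case
    using nz eq by (auto cong: map_cong)
next
  case (Prim f g)
  then obtain n xs' where xs: "xs = n # xs'" by (cases xs) auto
  have "rec_nat (stage f t xs') (\<lambda>i r. if r = 0 then 0 else stage g t ((r - 1) # i # xs')) n = Suc y
    \<Longrightarrow> rec_nat (stage f t' xs') (\<lambda>i r. if r = 0 then 0 else stage g t' ((r - 1) # i # xs')) n = Suc y"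
  proof (induction n arbitrary: y)
    case 0
    then show ?case using Prim.IH(1) Prim.prems(2) by simp
  next
    case (Suc n)
    then obtain z where z: "rec_nat (stage f t xs')
        (\<lambda>i r. if r = 0 then 0 else stage g t ((r - 1) # i # xs')) n = Suc z"
      by (cases "rec_nat (stage f t xs')
        (\<lambda>i r. if r = 0 then 0 else stage g t ((r - 1) # i # xs')) n") auto
    with Suc show ?case using Prim.IH(2)[of _ y] Prim.prems(2) by simp
  qed
  then show ?case using Prim.prems(1) xs by simp
next
  case (Mn f)
  have mono: "stage f t' xs = stage f t xs" if "stage f t xs \<noteq> 0" for xs
    using Mn.IH[OF _ Mn.prems(2)] that by (metis not0_implies_Suc)
  show ?case
    using Mn.prems unfolding stage_Mn_eq_Suc_iff
    by (metis less_nat_zero_code less_le_trans mono zero_neq_one)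
qed auto

lemma stage_sound: "stage f t xs = Suc y \<Longrightarrow> eval_recf f xs y"
proof (induction f arbitrary: xs y)
  case Zero
  then show ?case by (simp add: eval_Zero)
next
  case Succ
  then show ?case by (auto simp: eval_Succ split: list.splits)
next
  case (Proj i)
  then show ?case by (auto simp: eval_Proj split: if_splits)
next
  case (Comp f gs)
  have "eval_recf g xs (stage g t xs - 1)" if "g \<in> set gs" for g
    using Comp.prems that by (intro Comp.IH(2)) (auto split: if_splits)
  then have "list_all2 (\<lambda>g y. eval_recf g xs y) gs (map (\<lambda>g. stage g t xs - 1) gs)"
    by (simp add: list_all2_conv_all_nth)
  moreover have "eval_recf f (map (\<lambda>g. stage g t xs - 1) gs) y"
    using Comp.prems by (intro Comp.IH(1)) (auto split: if_splits)
  ultimately show ?case by (auto simp: eval_Comp)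
next
  case (Prim f g)
  then obtain n xs' where xs: "xs = n # xs'" by (cases xs) auto
  have "rec_nat (stage f t xs') (\<lambda>i r. if r = 0 then 0 else stage g t ((r - 1) # i # xs')) n = Suc y
    \<Longrightarrow> eval_recf (Prim f g) (n # xs') y"
  proof (induction n arbitrary: y)
    case 0
    then show ?case using Prim.IH(1) by (simp add: eval_Prim_0)
  next
    case (Suc n)
    then obtain z where z: "rec_nat (stage f t xs')
        (\<lambda>i r. if r = 0 then 0 else stage g t ((r - 1) # i # xs')) n = Suc z"
      by (cases "rec_nat (stage f t xs')
        (\<lambda>i r. if r = 0 then 0 else stage g t ((r - 1) # i # xs')) n") auto
    with Suc show ?case using Prim.IH(2)[of _ y] by (auto simp: eval_Prim_Suc)
  qed
  then show ?case using Prim.prems(1) xs by simp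
next
  case (Mn f)
  then have *: "stage f t (y # xs) = Suc 0" "\<forall>m<y. 1 < stage f t (m # xs)"
    by (auto simp: stage_Mn_eq_Suc_iff)
  have "\<exists>z. eval_recf f (m # xs) z \<and> z \<noteq> 0" if "m < y" for m
  proof -
    have "stage f t (m # xs) = Suc (stage f t (m # xs) - 1)" "stage f t (m # xs) - 1 \<noteq> 0"
      using *(2) that by auto
    then show ?thesis using Mn.IH by metis
  qed
  then show ?case using Mn.IH[OF *(1)] by (auto simp: eval_Mn)
qed

text \<open>Each evaluation rule has finitely many subcomputations, so a bound large enough for all
  of them exists.\<close>

lemma stage_complete:
  "eval_recf f xs y \<Longrightarrow> eventually (\<lambda>t. stage f t xs = Suc y) sequentially"
proof (induction rule: eval_recf.induct)
  case (ev_comp xs gs ys f z)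
  have "eventually (\<lambda>t. \<forall>i\<in>{..<length gs}. stage (gs ! i) t xs = Suc (ys ! i)) sequentially"
    using ev_comp.IH(1) by (intro eventually_ball_finite) (auto simp: list_all2_conv_all_nth)
  then show ?case using ev_comp.IH(2)
  proof eventually_elim
    case (elim t)
    have "map (\<lambda>g. stage g t xs - 1) gs = ys"
      using elim(1) ev_comp.IH(1) by (auto simp: list_all2_conv_all_nth intro!: nth_equalityI)
    moreover have "\<forall>g\<in>set gs. stage g t xs \<noteq> 0"
      using elim(1) by (auto simp: in_set_conv_nth)
    ultimately show ?case using elim(2) by auto
  qed
next
  case (ev_primS f g n xs y z)
  show ?case using ev_primS.IH by eventually_elim simp
next
  case (ev_mn f n xs)
  have "eventually (\<lambda>t. \<forall>m\<in>{..<n}. 1 < stage f t (m # xs)) sequentially"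
  proof (intro eventually_ball_finite ballI)
    fix m assume "m \<in> {..<n}"
    then obtain y where "eventually (\<lambda>t. stage f t (m # xs) = Suc y) sequentially" "y \<noteq> 0"
      using ev_mn.IH(2) by auto
    then show "eventually (\<lambda>t. 1 < stage f t (m # xs)) sequentially"
      by (auto elim: eventually_mono)
  qed simp
  then show ?case using ev_mn.IH(1) eventually_gt_at_top[of n]
    by eventually_elim (auto simp: stage_Mn_eq_Suc_iff)
qed (simp_all)

text \<open>The program \<open>f\<close> is fixed, so induction on it suffices and no numbering of
  programs is involved.\<close>

lemma rec_env_stage:
  "rec_env T \<Longrightarrow> (\<And>G. G \<in> set Gs \<Longrightarrow> rec_env G) \<Longrightarrow>
    rec_env (\<lambda>e. stage f (T e) (map (\<lambda>G. G e) Gs))"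
proof (induction f arbitrary: T Gs)
  case Zero
  then show ?case using rec_env_const[of 1] by simp
next
  case Succ
  then show ?case by (cases Gs) (auto intro!: rec_env_intros)
next
  case (Proj i)
  then show ?case by (cases "i < length Gs") (auto intro!: rec_env_intros)
next
  case (Comp f gs)
  have g: "rec_env (\<lambda>e. stage g (T e) (map (\<lambda>G. G e) Gs))" if "g \<in> set gs" for g
    using Comp that by blast
  have "dec_env (\<lambda>e. \<exists>g\<in>set gs'. stage g (T e) (map (\<lambda>G. G e) Gs) = 0)" if "set gs' \<subseteq> set gs" for gs'
    using that
  proof (induction gs')
    case Nil
    then show ?case using rec_env_const[of 0] by (simp add: dec_env_def)
  next
    case (Cons g gs')
    then show ?case by (simp) (intro dec_env_disj dec_env_zero g; simp)
  qed
  then have dec: "dec_env (\<lambda>e. \<exists>g\<in>set gs. stage g (T e) (map (\<lambda>G. G e) Gs) = 0)" by simp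
  have "rec_env (\<lambda>e. stage f (T e)
      (map (\<lambda>G. G e) (map (\<lambda>g e. stage g (T e) (map (\<lambda>G. G e) Gs) - 1) gs)))"
    using Comp.prems(1) g by (intro Comp.IH(1)) (auto intro!: rec_env_diff rec_env_const)
  then have "rec_env (\<lambda>e. stage f (T e)
      (map (\<lambda>g. stage g (T e) (map (\<lambda>G. G e) Gs) - 1) gs))"
    by (simp add: comp_def)
  then show ?case using dec by (auto intro!: rec_env_if rec_env_const)
next
  case (Prim f g)
  show ?case
  proof (cases Gs)
    case Nil
    then show ?thesis using rec_env_const[of 0] by simp
  next
    case (Cons G Gs')
    have sh: "rec_env (\<lambda>e. F (\<lambda>i. e (Suc (Suc i))))" if "rec_env F" for F
      using rec_env_shift[OF rec_env_shift[OF that]] .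
    have "rec_env (\<lambda>e. stage g (T (\<lambda>i. e (Suc (Suc i)))) (map (\<lambda>G. G e)
        ((\<lambda>e. e 0 - 1) # (\<lambda>e. e (Suc 0)) # map (\<lambda>G e. G (\<lambda>i. e (Suc (Suc i)))) Gs')))"
      using Prim.prems Cons by (intro Prim.IH(2) sh) (auto intro!: sh rec_env_intros)
    then have "rec_env (\<lambda>e. stage g (T (\<lambda>i. e (Suc (Suc i))))
       ((e 0 - 1) # e (Suc 0) # map (\<lambda>G. G (\<lambda>i. e (Suc (Suc i)))) Gs'))"
      by (simp add: comp_def)
    then show ?thesis using Cons Prim
      by (auto intro!: rec_env_primrec[where h = "\<lambda>r i e. if r = 0 then 0 else
          stage g (T e) ((r - 1) # i # map (\<lambda>G. G e) Gs')"] rec_env_if dec_env_zero rec_env_intros)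
  qed
next
  case (Mn f)
  have 1: "rec_env (\<lambda>e. stage f (T (\<lambda>i. e (Suc i))) (e 0 # map (\<lambda>G. G (\<lambda>i. e (Suc i))) Gs))"
    using Mn.IH[of "\<lambda>e. T (\<lambda>i. e (Suc i))" "(\<lambda>e. e 0) # map (\<lambda>G e. G (\<lambda>i. e (Suc i))) Gs"] Mn.prems
    by (auto simp: comp_def intro!: rec_env_var rec_env_shift)
  have 2: "rec_env (\<lambda>e. stage f (T (\<lambda>i. e (Suc (Suc i)))) (e 0 # map (\<lambda>G. G (\<lambda>i. e (Suc (Suc i)))) Gs))"
    using rec_env_skip[OF 1] by simp
  show ?case unfolding stage.simps(6)
    by (intro rec_env_sum rec_env_if dec_env_conj dec_env_eq dec_env_ball dec_env_less Mn.prems 1 2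
        rec_env_Suc rec_env_const rec_env_var)
qed

text \<open>Leads back from environments to argument lists of a given length: a variable beyond the
  end of the list is supplied by \<open>Zero\<close>.\<close>

lemma rec_env_at_list:
  assumes "rec_env F"
  shows "\<exists>r. \<forall>xs y. length xs = n \<longrightarrow>
    (eval_recf r xs y \<longleftrightarrow> y = F (\<lambda>i. if i < n then xs ! i else 0))"
proof -
  obtain r k where r: "\<forall>k'\<ge>k. \<forall>e y. eval_recf r (map e [0..<k']) y \<longleftrightarrow> y = F e"
    using assms unfolding rec_env_def by blast
  have "eval_recf (Comp r (map (\<lambda>i. if i < n then Proj i else Zero) [0..<k])) xs y
      \<longleftrightarrow> y = F (\<lambda>i. if i < n then xs ! i else 0)" if "length xs = n" for xs y
    unfolding eval_Comp
    by (subst list_all2_eval_map[where v = "\<lambda>i. if i < n then xs ! i else 0"])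
       (auto simp: eval_Proj eval_Zero that r)
  then show ?thesis by blast
qed

text \<open>Unbounded search is confined to a single \<open>Mn\<close> followed by a total function;
  the machines constructed below have this form.\<close>

lemma partial_recursive_search:
  assumes R: "dec_env (\<lambda>e. R (e (Suc 0)) (e 0))" and h: "rec_env (\<lambda>e. h (e (Suc 0)) (e 0))"
  shows "partial_recursive (\<lambda>x. if \<exists>z. R x z then Some (h x (LEAST z. R x z)) else None)"
proof -
  \<comment> \<open>The negation is taken because \<open>Mn\<close> looks for the value
    \<open>0\<close>.\<close>
  obtain r where "\<forall>xs y. length xs = 2 \<longrightarrow>
    (eval_recf r xs y \<longleftrightarrow> y = (if \<not> R (if Suc 0 < 2 then xs ! Suc 0 else 0) (if 0 < (2::nat) then xs ! 0 else 0)
       then 1 else 0))"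
    using rec_env_at_list[OF dec_env_not[OF R, unfolded dec_env_def], of 2] by blast
  then have r: "eval_recf r [z, x] y \<longleftrightarrow> y = (if R x z then 0 else 1)" for x y z
    by (auto dest!: spec[of _ "[z, x]"])
  obtain s where "\<forall>xs y. length xs = 2 \<longrightarrow>
    (eval_recf s xs y \<longleftrightarrow> y = h (if Suc 0 < 2 then xs ! Suc 0 else 0) (if 0 < (2::nat) then xs ! 0 else 0))"
    using rec_env_at_list[OF h, of 2] by blast
  then have s: "eval_recf s [z, x] y \<longleftrightarrow> y = h x z" for x y z
    by (auto dest!: spec[of _ "[z, x]"])
  have mn: "eval_recf (Mn r) [x] z \<longleftrightarrow> R x z \<and> (\<forall>m<z. \<not> R x m)" for x z
    by (auto simp: eval_Mn r)
  have least: "R x z \<and> (\<forall>m<z. \<not> R x m) \<longleftrightarrow> (\<exists>z. R x z) \<and> z = (LEAST z. R x z)" for x z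
    by (metis LeastI not_less_Least linorder_neqE_nat)
  have "eval_recf (Comp s [Mn r, Proj 0]) [x] y \<longleftrightarrow>
      (if \<exists>z. R x z then Some (h x (LEAST z. R x z)) else None) = Some y" for x y
    by (auto simp: eval_Comp list_all2_Cons1 mn least eval_Proj s)
  then show ?thesis unfolding partial_recursive_def by blast
qed

section \<open>Binary strings and their codes\<close>

lemma Suc_str_code: "Suc (str_code s) =
    (\<Sum>i<length s. (if s ! i then 1 else 0) * 2 ^ (length s - 1 - i)) + 2 ^ length s"
  by (simp add: str_code_def Suc_diff_1)

lemma str_code_Nil [simp]: "str_code [] = 0"
  by (simp add: str_code_def)

text \<open>\<open>Suc (str_code s)\<close> is the value of the numeral \<open>1s\<close>, and a
  further digit doubles it and adds the digit.\<close>

lemma Suc_str_code_snoc: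
  "Suc (str_code (s @ [b])) = 2 * Suc (str_code s) + (if b then 1 else 0)"
proof -
  have "(\<Sum>i<length s. (if (s @ [b]) ! i then 1 else 0) * 2 ^ (length s - i)) =
      (\<Sum>i<length s. 2 * ((if s ! i then 1 else 0) * 2 ^ (length s - 1 - i)) :: nat)"
  proof (rule sum.cong[OF refl])
    fix i assume "i \<in> {..<length s}"
    then have "length s - i = Suc (length s - 1 - i)" "i < length s" by auto
    then show "(if (s @ [b]) ! i then 1 else 0) * 2 ^ (length s - i) =
        2 * ((if s ! i then 1 else 0) * 2 ^ (length s - 1 - i) :: nat)"
      by (simp only: nth_append) simp
  qed
  then show ?thesis
    unfolding Suc_str_code by (simp add: sum_distrib_left)
qed

lemma str_code_bounds: "2 ^ length s \<le> Suc (str_code s)" "Suc (str_code s) < 2 ^ Suc (length s)"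
proof -
  have "2 ^ length s \<le> Suc (str_code s) \<and> Suc (str_code s) < 2 ^ Suc (length s)"
  proof (induction s rule: rev_induct)
    case (snoc b s)
    then show ?case by (simp only: Suc_str_code_snoc) auto
  qed simp
  then show "2 ^ length s \<le> Suc (str_code s)" "Suc (str_code s) < 2 ^ Suc (length s)" by auto
qed

lemma str_code_inject: "str_code s = str_code t \<Longrightarrow> s = t"
proof (induction s arbitrary: t rule: rev_induct)
  case Nil
  show ?case
  proof (cases t rule: rev_cases)
    case (snoc u c)
    then show ?thesis using Nil Suc_str_code_snoc[of u c] by simp
  qed simp
next
  case (snoc b s)
  show ?case
  proof (cases t rule: rev_cases)
    case Nil
    then show ?thesis using snoc.prems Suc_str_code_snoc[of s b] by simp
  next
    case t: (snoc u c)
    have *: "2 * Suc (str_code s) + (if b then 1 else 0) = 2 * Suc (str_code u) + (if c then 1 else 0)"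
      using snoc.prems t Suc_str_code_snoc[of s b] Suc_str_code_snoc[of u c] by simp
    then have "b = c" by (cases b; cases c; simp; presburger)
    with * have "str_code s = str_code u" by simp
    with snoc.IH \<open>b = c\<close> t show ?thesis by simp
  qed
qed

lemma str_code_surj: "\<exists>s. str_code s = c"
proof (induction c rule: less_induct)
  case (less c)
  show ?case
  proof (cases "c = 0")
    case True
    then show ?thesis using str_code_Nil by blast
  next
    case False
    then have "Suc c div 2 - 1 < c" by presburger
    then obtain s where s: "str_code s = Suc c div 2 - 1" using less by blast
    then have "Suc (str_code (s @ [odd (Suc c)])) = Suc c"
      using False unfolding Suc_str_code_snoc s
      by (cases "odd (Suc c)") (simp_all, presburger+)
    then show ?thesis by blast
  qed
qed

lemma bij_str_code: "bij str_code"
  using str_code_inject str_code_surj by (metis bijI injI surjI)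

definition str_decode :: "nat \<Rightarrow> bool list" where
  "str_decode = inv str_code"

lemma str_decode_code [simp]: "str_decode (str_code s) = s"
  using bij_str_code by (simp add: str_decode_def bij_is_inj)

lemma str_code_decode [simp]: "str_code (str_decode c) = c"
  using bij_str_code by (simp add: str_decode_def bij_is_surj surj_f_inv_f)

text \<open>The integer part of the binary logarithm of \<open>Suc c\<close>, written as a bounded
  search so that it is visibly recursive.\<close>

definition strlen :: "nat \<Rightarrow> nat" where
  "strlen c = bounded_least (Suc c) (\<lambda>i. Suc c < 2 ^ Suc i)"

lemma strlen_str_code [simp]: "strlen (str_code s) = length s"
proof -
  have l: "length s < Suc (str_code s)"
    using str_code_bounds(1)[of s] less_exp[of "length s"] by linarith
  have "strlen (str_code s) = (LEAST i. Suc (str_code s) < 2 ^ Suc i)"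
    unfolding strlen_def using l str_code_bounds(2) by (intro bounded_least_eq) blast
  also have "\<dots> = length s"
  proof (rule Least_equality)
    fix i assume "Suc (str_code s) < 2 ^ Suc i"
    then have "(2::nat) ^ length s < 2 ^ Suc i" using str_code_bounds(1)[of s] by linarith
    then show "length s \<le> i" by (subst (asm) power_strict_increasing_iff) auto
  qed (rule str_code_bounds)
  finally show ?thesis .
qed

lemma length_str_decode [simp]: "length (str_decode c) = strlen c"
  by (metis strlen_str_code str_code_decode)

lemma strlen_bounds: "2 ^ strlen c \<le> Suc c" "Suc c < 2 ^ Suc (strlen c)"
  using str_code_bounds[of "str_decode c"] by simp_all

lemma strlen_eqI: "2 ^ l \<le> Suc c \<Longrightarrow> Suc c < 2 ^ Suc l \<Longrightarrow> strlen c = l"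
proof -
  assume "2 ^ l \<le> Suc c" "Suc c < 2 ^ Suc l"
  then have "(2::nat) ^ l < 2 ^ Suc (strlen c)" "(2::nat) ^ strlen c < 2 ^ Suc l"
    using strlen_bounds[of c] by linarith+
  then show ?thesis by (simp only: power_strict_increasing_iff)
qed

lemma rec_env_strlen: "rec_env G \<Longrightarrow> rec_env (\<lambda>e. strlen (G e))"
  unfolding strlen_def by (rule rec_env_comp1) (intro rec_env_intros)

lemma Suc_str_code_append:
  "Suc (str_code (s @ x)) = Suc (str_code s) * 2 ^ length x + (Suc (str_code x) - 2 ^ length x)"
proof (induction x rule: rev_induct)
  case (snoc b x)
  have "Suc (str_code (s @ x @ [b])) = 2 * Suc (str_code (s @ x)) + (if b then 1 else 0)"
    using Suc_str_code_snoc[of "s @ x" b] by simp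
  then show ?case using str_code_bounds(1)[of x]
    by (simp only: snoc.IH Suc_str_code_snoc) (simp add: algebra_simps)
qed simp

lemma Suc_str_code_replicate_True: "Suc (Suc (str_code (replicate a True))) = 2 ^ Suc a"
proof (induction a)
  case (Suc a)
  have "replicate (Suc a) True = replicate a True @ [True]"
    by (simp add: replicate_append_same)
  then show ?case using Suc by (simp only: Suc_str_code_snoc) simp
qed simp

text \<open>The numeral \<open>1 1^a 0\<close> has the value \<open>2 ^ (a + 2) - 2\<close>; adding
  \<open>2\<close> on the left avoids truncated subtraction.\<close>

lemma str_code_unary: "Suc (str_code (replicate a True @ [False])) + 2 = 2 ^ (a + 2)"
  using Suc_str_code_replicate_True[of a] by (simp only: Suc_str_code_snoc) simp

text \<open>Halving the floor of \<open>2 ^ Suc n * frac x\<close> gives the floor for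
  \<open>n\<close>, and the remainder is exactly the bit that is appended.\<close>

lemma Suc_str_code_prefix_bits:
  "Suc (str_code (prefix_bits x n)) = 2 ^ n + nat \<lfloor>2 ^ n * frac x\<rfloor>"
proof (induction n)
  case 0
  have "\<lfloor>frac x\<rfloor> = 0" by (simp add: floor_eq_iff frac_lt_1)
  then show ?case by (simp add: prefix_bits_def)
next
  case (Suc n)
  let ?m = "\<lfloor>2 ^ Suc n * frac x\<rfloor>"
  have "?m div 2 = \<lfloor>2 ^ n * frac x\<rfloor>"
    using floor_divide_real_eq_div[of 2 "2 ^ Suc n * frac x"] by (simp add: field_simps)
  then have m: "?m = 2 * \<lfloor>2 ^ n * frac x\<rfloor> + (if odd ?m then 1 else 0)"
    using div_mult_mod_eq[of ?m 2] by (simp add: odd_iff_mod_2_eq_one even_iff_mod_2_eq_zero)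
  have nonneg: "0 \<le> \<lfloor>2 ^ n * frac x\<rfloor>" by simp
  have "nat i = 2 * nat j + (if c then 1 else 0)"
    if "i = 2 * j + (if c then 1 else 0)" "0 \<le> j" for i j :: int and c
    using that by (cases c) (simp_all add: nat_add_distrib nat_mult_distrib)
  from this[OF m nonneg] have "nat ?m = 2 * nat \<lfloor>2 ^ n * frac x\<rfloor> + (if odd ?m then 1 else 0)" .
  moreover have "prefix_bits x (Suc n) = prefix_bits x n @ [odd ?m]"
    by (simp add: prefix_bits_def)
  ultimately show ?case by (simp only: Suc_str_code_snoc Suc) simp
qed

section \<open>Prefix-free machines\<close>

lemma prefix_free_subset: "B \<subseteq> A \<Longrightarrow> prefix_free A \<Longrightarrow> prefix_free B"
  unfolding prefix_free_def by (meson subsetD)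

text \<open>Induction on a bound for the lengths. Either the empty string is the only element, or
  the set splits by the first bit into two prefix-free sets, each contributing half of its own
  sum.\<close>

lemma kraft_inequality:
  assumes "finite B" "prefix_free B"
  shows "(\<Sum>p\<in>B. (1/2 :: real) ^ length p) \<le> 1"
proof -
  have "(\<Sum>p\<in>B. (1/2 :: real) ^ length p) \<le> 1"
    if "finite B" "prefix_free B" "\<forall>p\<in>B. length p \<le> n" for n B
    using that
  proof (induction n arbitrary: B)
    case 0
    then have "B = {} \<or> B = {[]}" by auto
    then show ?case by auto
  next
    case (Suc n)
    show ?case
    proof (cases "[] \<in> B")
      case True
      then have "[] = p" if "p \<in> B" for p
        using Suc.prems(2) that Nil_prefix[of p] unfolding prefix_free_def by blast
      then have "B = {[]}" using True by blast
      then show ?thesis by simp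
    next
      case False
      define C where "C b = {p. b # p \<in> B}" for b
      have B: "B = (#) True ` C True \<union> (#) False ` C False"
      proof
        show "B \<subseteq> (#) True ` C True \<union> (#) False ` C False"
        proof
          fix p assume p: "p \<in> B"
          with False obtain c u where "p = c # u" by (cases p) auto
          with p show "p \<in> (#) True ` C True \<union> (#) False ` C False"
            by (cases c) (auto simp: C_def)
        qed
      qed (auto simp: C_def)
      have fin: "finite (C b)" for b
        using finite_vimageI[OF Suc.prems(1), of "(#) b"] by (simp add: C_def vimage_def)
      have le: "(\<Sum>p\<in>C b. (1/2 :: real) ^ length p) \<le> 1" for b
      proof (rule Suc.IH[OF fin])
        show "prefix_free (C b)"
          using Suc.prems(2) unfolding prefix_free_def C_def by fastforce
        show "\<forall>p\<in>C b. length p \<le> n" using Suc.prems(3) by (auto simp: C_def)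
      qed
      have half: "(\<Sum>p\<in>(#) b ` C b. (1/2 :: real) ^ length p) = 1/2 * (\<Sum>p\<in>C b. (1/2) ^ length p)" for b
        by (subst sum.reindex) (auto simp: sum_distrib_left)
      have "(\<Sum>p\<in>B. (1/2 :: real) ^ length p) =
          (\<Sum>p\<in>(#) True ` C True. (1/2) ^ length p) + (\<Sum>p\<in>(#) False ` C False. (1/2) ^ length p)"
        unfolding B using fin by (subst sum.union_disjoint) auto
      also have "\<dots> = 1/2 * (\<Sum>p\<in>C True. (1/2) ^ length p) + 1/2 * (\<Sum>p\<in>C False. (1/2) ^ length p)"
        by (simp only: half)
      finally show ?thesis using le[of True] le[of False] by linarith
    qed
  qed
  moreover have "\<forall>p\<in>B. length p \<le> Max (length ` B)" using assms(1) by simp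
  ultimately show ?thesis using assms by blast
qed

section \<open>Strings with a program shorter than themselves\<close>

definition compressible_strings :: "(bool list \<Rightarrow> bool list option) \<Rightarrow> bool list set" where
  "compressible_strings V = {s. Hc V s < enat (length s)}"

lemma compressible_strings_iff:
  "s \<in> compressible_strings V \<longleftrightarrow> (\<exists>p. V p = Some s \<and> length p < length s)"
  unfolding compressible_strings_def Hc_def by (auto simp: INF_less_iff)

text \<open>Distinct strings have distinct programs. Each string is at least one bit longer than its
  program, which gains the factor \<open>1/2\<close> over Kraft's inequality for the
  programs.\<close>

lemma kraft_compressible_strings:
  assumes V: "prefix_free_machine V" and F: "finite F" "F \<subseteq> compressible_strings V"
  shows "(\<Sum>s\<in>F. (1/2 :: real) ^ length s) \<le> 1/2"
proof -
  obtain P where P: "\<And>s. s \<in> F \<Longrightarrow> V (P s) = Some s \<and> length (P s) < length s"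
    using F(2) unfolding compressible_strings_iff subset_iff by metis
  have inj: "inj_on P F"
    using P by (metis inj_onI option.inject)
  have "P ` F \<subseteq> dom V" using P by blast
  then have "prefix_free (P ` F)"
    using V prefix_free_subset by (simp add: prefix_free_machine_def)
  then have "(\<Sum>p\<in>P ` F. (1/2 :: real) ^ length p) \<le> 1"
    using F(1) by (intro kraft_inequality) auto
  then have *: "(\<Sum>s\<in>F. (1/2 :: real) ^ length (P s)) \<le> 1"
    using inj by (simp add: sum.reindex)
  have "(1/2 :: real) ^ length s \<le> 1/2 * (1/2) ^ length (P s)" if "s \<in> F" for s
  proof -
    have "Suc (length (P s)) \<le> length s" using P[OF that] by simp
    then have "(1/2 :: real) ^ length s \<le> (1/2) ^ Suc (length (P s))"
      by (intro power_decreasing) auto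
    then show ?thesis by simp
  qed
  then have "(\<Sum>s\<in>F. (1/2 :: real) ^ length s) \<le> (\<Sum>s\<in>F. 1/2 * (1/2) ^ length (P s))"
    by (rule sum_mono)
  also have "\<dots> = 1/2 * (\<Sum>s\<in>F. (1/2) ^ length (P s))" by (simp only: sum_distrib_left)
  finally show ?thesis using * by linarith
qed

lemma partial_recursive_str_decode:
  "partial_recursive \<phi> \<Longrightarrow> partial_recursive_str (\<lambda>p. map_option str_decode (\<phi> (str_code p)))"
  unfolding partial_recursive_str_def
  by (rule exI[of _ \<phi>]) (auto simp: option.map_comp comp_def option.map_ident)

lemma partial_recursive_str_stage:
  assumes "partial_recursive_str C"
  obtains f where "\<And>p s. C p = Some s \<Longrightarrow>
      eventually (\<lambda>t. stage f t [str_code p] = Suc (str_code s)) sequentially"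
    and "\<And>c t x. stage f t [c] = Suc x \<Longrightarrow> C (str_decode c) = Some (str_decode x)"
proof -
  obtain \<phi> f where f: "\<And>x y. eval_recf f [x] y \<longleftrightarrow> \<phi> x = Some y"
    and \<phi>: "\<And>p. \<phi> (str_code p) = map_option str_code (C p)"
    using assms unfolding partial_recursive_str_def partial_recursive_def by blast
  show ?thesis
  proof
    show "eventually (\<lambda>t. stage f t [str_code p] = Suc (str_code s)) sequentially"
      if "C p = Some s" for p s
      using that by (intro stage_complete) (simp add: f \<phi>)
    show "C (str_decode c) = Some (str_decode x)" if "stage f t [c] = Suc x" for c t x
      using stage_sound[OF that] \<phi>[of "str_decode c"] by (cases "C (str_decode c)") (auto simp: f)
  qed
qed

lemma enumerate_compressible_strings:
  assumes "prefix_free_machine V"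
  obtains A where "dec_env (\<lambda>e. A (e 0) (e (Suc 0)))"
    and "\<And>k c. A k c \<Longrightarrow> c < k"
    and "\<And>k k' c. A k c \<Longrightarrow> k \<le> k' \<Longrightarrow> A k' c"
    and "\<And>c. str_decode c \<in> compressible_strings V \<longleftrightarrow> (\<exists>k. A k c)"
proof -
  obtain f where complete: "\<And>p s. V p = Some s \<Longrightarrow>
      eventually (\<lambda>t. stage f t [str_code p] = Suc (str_code s)) sequentially"
    and sound: "\<And>c t x. stage f t [c] = Suc x \<Longrightarrow> V (str_decode c) = Some (str_decode x)"
    using partial_recursive_str_stage assms unfolding prefix_free_machine_def by blast
  \<comment> \<open>By stage \<open>k\<close> only programs and outputs with codes below
    \<open>k\<close> and computations bounded by \<open>k\<close> count, so every stage is finite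
    and decidable.\<close>
  define A where "A k c \<longleftrightarrow> c < k \<and> (\<exists>p<k. strlen p < strlen c \<and> stage f k [p] = Suc c)" for k c
  show ?thesis
  proof
    have "rec_env (\<lambda>e. stage f (e (Suc 0)) [e 0])"
      using rec_env_stage[of "\<lambda>e. e (Suc 0)" "[\<lambda>e. e 0]" f] by (simp add: rec_env_var)
    then show "dec_env (\<lambda>e. A (e 0) (e (Suc 0)))"
      unfolding A_def by (intro rec_env_intros rec_env_strlen)
    show "c < k" if "A k c" for k c using that by (simp add: A_def)
    show "A k' c" if "A k c" "k \<le> k'" for k k' c
      using that stage_mono[OF _ \<open>k \<le> k'\<close>] unfolding A_def by (meson less_le_trans)
    show "str_decode c \<in> compressible_strings V \<longleftrightarrow> (\<exists>k. A k c)" for c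
    proof
      assume "str_decode c \<in> compressible_strings V"
      then obtain p where p: "V p = Some (str_decode c)" "length p < strlen c"
        by (auto simp: compressible_strings_iff)
      from complete[OF p(1)] have "eventually (\<lambda>t. stage f t [str_code p] = Suc c) sequentially"
        by simp
      then have "eventually (\<lambda>t. A t c) sequentially"
        using eventually_gt_at_top[of c] eventually_gt_at_top[of "str_code p"]
        by eventually_elim (use p in \<open>auto simp: A_def\<close>)
      then show "\<exists>k. A k c" by (auto simp: eventually_sequentially)
    next
      assume "\<exists>k. A k c"
      then obtain k p where "strlen p < strlen c" "stage f k [p] = Suc c"
        by (auto simp: A_def)
      then show "str_decode c \<in> compressible_strings V"
        using sound unfolding compressible_strings_iff by (metis length_str_decode)
    qed
  qed
qed

text \<open>Postprocessing costs only a constant: a machine runs \<open>U\<close> on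
  \<open>q\<close>, searches for \<open>z\<close> and outputs \<open>h\<close>. Its domain lies in
  that of \<open>U\<close>, hence is prefix-free. As \<open>z\<close> also bounds the simulation of
  \<open>U\<close>, the condition \<open>R\<close> is required for all large
  \<open>z\<close>.\<close>

lemma optimal_machine_image:
  assumes V: "optimal_machine V" and U: "prefix_free_machine U"
    and R: "dec_env (\<lambda>e. R (e (Suc 0)) (e 0))" and h: "rec_env (\<lambda>e. h (e (Suc 0)) (e 0))"
  shows "\<exists>d. \<forall>q w. U q = Some w \<longrightarrow> eventually (R (str_code w)) sequentially \<longrightarrow>
    (\<exists>z q'. R (str_code w) z \<and> V q' = Some (str_decode (h (str_code w) z)) \<and>
       length q' \<le> length q + d)"
proof -
  obtain f where complete: "\<And>p s. U p = Some s \<Longrightarrow>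
      eventually (\<lambda>t. stage f t [str_code p] = Suc (str_code s)) sequentially"
    and sound: "\<And>c t x. stage f t [c] = Suc x \<Longrightarrow> U (str_decode c) = Some (str_decode x)"
    using partial_recursive_str_stage U unfolding prefix_free_machine_def by blast
  define R' where "R' c z \<longleftrightarrow> stage f z [c] \<noteq> 0 \<and> R (stage f z [c] - 1) z" for c z
  define h' where "h' c z = h (stage f z [c] - 1) z" for c z
  define \<phi> where "\<phi> c = (if \<exists>z. R' c z then Some (h' c (LEAST z. R' c z)) else None)" for c
  define C where "C p = map_option str_decode (\<phi> (str_code p))" for p
  have st: "rec_env (\<lambda>e. stage f (e 0) [e (Suc 0)] - 1)" "rec_env (\<lambda>e. stage f (e 0) [e (Suc 0)])"
    using rec_env_stage[of "\<lambda>e. e 0" "[\<lambda>e. e (Suc 0)]" f]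
    by (simp_all add: rec_env_var rec_env_diff rec_env_const)
  have R2: "dec_env (\<lambda>e. R (stage f (e 0) [e (Suc 0)] - 1) (e 0))"
    using rec_env_comp2[of "\<lambda>z c. if R c z then 1 else 0", OF R[unfolded dec_env_def] rec_env_var st(1)]
    unfolding dec_env_def .
  have "dec_env (\<lambda>e. R' (e (Suc 0)) (e 0))"
    unfolding R'_def by (intro dec_env_conj dec_env_not dec_env_zero st R2)
  moreover have "rec_env (\<lambda>e. h' (e (Suc 0)) (e 0))"
    unfolding h'_def by (rule rec_env_comp2[of "\<lambda>z c. h c z", OF h rec_env_var st(1)])
  ultimately have "partial_recursive \<phi>"
    unfolding \<phi>_def by (rule partial_recursive_search)
  then have "partial_recursive_str C"
    unfolding C_def by (rule partial_recursive_str_decode)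
  moreover have "dom C \<subseteq> dom U"
  proof
    fix p assume "p \<in> dom C"
    then obtain z where "R' (str_code p) z"
      by (auto simp: C_def \<phi>_def split: if_splits)
    then obtain x where "stage f z [str_code p] = Suc x"
      unfolding R'_def using not0_implies_Suc by blast
    then show "p \<in> dom U" using sound[of z "str_code p" x] by auto
  qed
  then have "prefix_free (dom C)"
    using U prefix_free_subset by (simp add: prefix_free_machine_def)
  ultimately have "prefix_free_machine C" by (simp add: prefix_free_machine_def)
  then obtain d where d: "\<And>p. p \<in> dom C \<Longrightarrow> \<exists>q\<in>dom V. V q = C p \<and> length q \<le> length p + d"
    using V unfolding optimal_machine_def by blast
  show ?thesis
  proof (rule exI[of _ d], intro allI impI)
    fix q w assume qw: "U q = Some w" "eventually (R (str_code w)) sequentially"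
    have "eventually (R' (str_code q)) sequentially"
      using complete[OF qw(1)] qw(2) by eventually_elim (simp add: R'_def)
    then have ex: "\<exists>z. R' (str_code q) z" by (auto simp: eventually_sequentially)
    define z where "z = (LEAST z. R' (str_code q) z)"
    have Rz: "R' (str_code q) z" using ex unfolding z_def by (rule LeastI_ex)
    then obtain x where x: "stage f z [str_code q] = Suc x"
      unfolding R'_def using not0_implies_Suc by blast
    then have xw: "x = str_code w" using sound[OF x] qw(1) by auto
    have "C q = Some (str_decode (h (str_code w) z))"
      using ex x xw by (simp add: C_def \<phi>_def h'_def flip: z_def)
    with d[of q] obtain q' where "V q' = Some (str_decode (h (str_code w) z))"
      "length q' \<le> length q + d" by auto
    then show "\<exists>z q'. R (str_code w) z \<and> V q' = Some (str_decode (h (str_code w) z)) \<and>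
       length q' \<le> length q + d"
      using Rz x xw unfolding R'_def by auto
  qed
qed

text \<open>The program \<open>1\<^sup>a 0 x\<close> with \<open>|x| = m a + b\<close> is self-delimiting. With \<open>x\<close> the binary notation of
  \<open>N\<close>, both \<open>a\<close> and \<open>N\<close> can be read off its code.\<close>

locale unary_header =
  fixes m b :: nat
begin

text \<open>A program with header \<open>a\<close> has length \<open>Suc m * a + 1 + b\<close>, so
  its length alone determines \<open>a\<close>.\<close>

definition header :: "nat \<Rightarrow> nat" where
  "header c = (strlen c - 1 - b) div Suc m"

definition payload :: "nat \<Rightarrow> nat" where
  "payload c = Suc c mod 2 ^ (m * header c + b)"

text \<open>The digits in front of the payload must form the numeral \<open>1 1^a 0\<close>, whose
  value is \<open>2 ^ (a + 2) - 2\<close>.\<close>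

definition valid :: "nat \<Rightarrow> bool" where
  "valid c \<longleftrightarrow> Suc c div 2 ^ (m * header c + b) + 2 = 2 ^ (header c + 2)"

lemma rec_env_header: "rec_env G \<Longrightarrow> rec_env (\<lambda>e. header (G e))"
  unfolding header_def by (intro rec_env_intros rec_env_strlen)

lemma rec_env_payload: "rec_env G \<Longrightarrow> rec_env (\<lambda>e. payload (G e))"
  unfolding payload_def by (intro rec_env_intros rec_env_header)

lemma dec_env_valid: "rec_env G \<Longrightarrow> dec_env (\<lambda>e. valid (G e))"
  unfolding valid_def by (intro rec_env_intros rec_env_header)

lemma valid_imp:
  assumes "valid (str_code p)"
  obtains x where "p = replicate (header (str_code p)) True @ False # x"
    "length x = m * header (str_code p) + b"
proof -
  let ?a = "header (str_code p)"
  let ?l = "m * ?a + b"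
  have "?l \<le> length p"
  proof (rule ccontr)
    assume "\<not> ?l \<le> length p"
    then have "(2::nat) ^ Suc (length p) \<le> 2 ^ ?l" by (intro power_increasing) auto
    then have "Suc (str_code p) div 2 ^ ?l = 0"
      using str_code_bounds(2)[of p] by (intro div_less) linarith
    then show False using assms by (simp add: valid_def) presburger
  qed
  then obtain u x where p: "p = u @ x" "length x = ?l"
    by (metis append_take_drop_id diff_diff_cancel length_drop)
  have "Suc (str_code x) - 2 ^ ?l < 2 ^ ?l"
    using str_code_bounds[of x] p(2) by simp
  moreover have "Suc (str_code p) = Suc (str_code u) * 2 ^ ?l + (Suc (str_code x) - 2 ^ ?l)"
    using Suc_str_code_append[of u x] p by simp
  moreover have "(S * k + N) div k = S" if "N < k" for S k N :: nat
    using that by simp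
  ultimately have "Suc (str_code p) div 2 ^ ?l = Suc (str_code u)" by presburger
  then have "Suc (str_code u) + 2 = 2 ^ (?a + 2)" using assms by (simp add: valid_def)
  then have "str_code u = str_code (replicate ?a True @ [False])"
    using str_code_unary[of ?a] by linarith
  then have "u = replicate ?a True @ [False]" by (rule str_code_inject)
  then have "p = replicate ?a True @ False # x" using p(1) by (metis append_Cons append_Nil append_assoc)
  with p(2) show ?thesis using that by blast
qed

lemma valid_code:
  assumes N: "N < 2 ^ (m * a + b)"
  obtains p where "valid (str_code p)" "header (str_code p) = a" "payload (str_code p) = N"
    "length p = a + 1 + (m * a + b)"
proof -
  let ?l = "m * a + b"
  define x where "x = str_decode (2 ^ ?l + N - 1)"
  have sc: "Suc (str_code x) = 2 ^ ?l + N" by (simp add: x_def)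
  have lx: "length x = ?l"
    using N sc strlen_eqI[of ?l "2 ^ ?l + N - 1"] by (simp add: x_def)
  define p where "p = (replicate a True @ [False]) @ x"
  have l: "length p = a + 1 + ?l" by (simp add: p_def lx)
  have "header (str_code p) = (a + m * a) div Suc m" by (simp add: header_def l)
  also have "a + m * a = a * Suc m" by simp
  also have "\<dots> div Suc m = a" by (rule nonzero_mult_div_cancel_right) simp
  finally have hd: "header (str_code p) = a" .
  have "Suc (str_code p) = Suc (str_code (replicate a True @ [False])) * 2 ^ ?l + N"
    unfolding p_def Suc_str_code_append sc lx by simp
  moreover have "(S * k + N) div k = S" "(S * k + N) mod k = N" if "N < k" for S k :: nat
    using that by simp_all
  ultimately have "Suc (str_code p) div 2 ^ ?l = Suc (str_code (replicate a True @ [False]))"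
    "Suc (str_code p) mod 2 ^ ?l = N"
    using N by metis+
  then show ?thesis
    using that[of p] hd l str_code_unary[of a] by (simp only: valid_def payload_def)
qed

text \<open>The machine decodes \<open>a\<close> and \<open>N\<close> from its program and then
  searches for \<open>z\<close>. If one valid program is a prefix of another, their first zeros
  coincide, so both have the same header and therefore the same length.\<close>

lemma optimal_machine_upper_bound:
  assumes U: "optimal_machine U"
    and R: "dec_env (\<lambda>e. R (e (Suc (Suc 0))) (e (Suc 0)) (e 0))"
    and h: "rec_env (\<lambda>e. h (e (Suc (Suc 0))) (e (Suc 0)) (e 0))"
  shows "\<exists>d. \<forall>a N. N < 2 ^ (m * a + b) \<longrightarrow> (\<exists>z. R a N z) \<longrightarrow>
    (\<exists>q. U q = Some (str_decode (h a N (LEAST z. R a N z))) \<and>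
       length q \<le> a + 1 + (m * a + b) + d)"
proof -
  define R' where "R' c z \<longleftrightarrow> valid c \<and> R (header c) (payload c) z" for c z
  define h' where "h' c z = h (header c) (payload c) z" for c z
  define \<phi> where "\<phi> c = (if \<exists>z. R' c z then Some (h' c (LEAST z. R' c z)) else None)" for c
  define C where "C p = map_option str_decode (\<phi> (str_code p))" for p
  have R2: "dec_env (\<lambda>e. R (header (e (Suc 0))) (payload (e (Suc 0))) (e 0))"
    using rec_env_comp3[of "\<lambda>z N a. if R a N z then 1 else 0", OF R[unfolded dec_env_def]
        rec_env_var rec_env_payload[OF rec_env_var] rec_env_header[OF rec_env_var]]
    unfolding dec_env_def .
  have "dec_env (\<lambda>e. R' (e (Suc 0)) (e 0))"
    unfolding R'_def by (intro dec_env_conj dec_env_valid rec_env_var R2)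
  moreover have "rec_env (\<lambda>e. h' (e (Suc 0)) (e 0))"
    unfolding h'_def by (rule rec_env_comp3[of "\<lambda>z N a. h a N z", OF h
        rec_env_var rec_env_payload[OF rec_env_var] rec_env_header[OF rec_env_var]])
  ultimately have "partial_recursive \<phi>"
    unfolding \<phi>_def by (rule partial_recursive_search)
  then have "partial_recursive_str C"
    unfolding C_def by (rule partial_recursive_str_decode)
  moreover have "prefix_free (dom C)"
    unfolding prefix_free_def
  proof (intro ballI impI)
    fix p q assume "p \<in> dom C" "q \<in> dom C" and pq: "prefix p q"
    then have v: "valid (str_code p)" "valid (str_code q)"
      by (auto simp: C_def \<phi>_def R'_def split: if_splits)
    obtain x where x: "p = replicate (header (str_code p)) True @ False # x"
      "length x = m * header (str_code p) + b" by (rule valid_imp[OF v(1)])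
    obtain y where y: "q = replicate (header (str_code q)) True @ False # y"
      "length y = m * header (str_code q) + b" by (rule valid_imp[OF v(2)])
    have "i = j \<and> prefix x y" if "prefix (replicate i True @ False # x) (replicate j True @ False # y)"
      for i j and x y :: "bool list"
      using that
    proof (induction i arbitrary: j)
      case 0
      then show ?case by (cases j) auto
    next
      case (Suc i)
      then show ?case by (cases j) auto
    qed
    then have "header (str_code p) = header (str_code q) \<and> prefix x y"
      using pq x(1) y(1) by metis
    moreover from this have "x = y" 
      using x(2) y(2) by (auto simp: prefix_def)
    ultimately show "p = q" using x(1) y(1) by metis
  qed
  ultimately have "prefix_free_machine C" by (simp add: prefix_free_machine_def)
  then obtain d where d: "\<And>p. p \<in> dom C \<Longrightarrow> \<exists>q\<in>dom U. U q = C p \<and> length q \<le> length p + d"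
    using U unfolding optimal_machine_def by blast
  show ?thesis
  proof (intro exI[of _ d] allI impI)
    fix a N assume N: "N < 2 ^ (m * a + b)" and ex: "\<exists>z. R a N z"
    obtain p where p: "valid (str_code p)" "header (str_code p) = a" "payload (str_code p) = N"
      "length p = a + 1 + (m * a + b)" by (rule valid_code[OF N])
    have R'_eq: "R' (str_code p) = R a N" using p by (simp add: R'_def fun_eq_iff)
    have "C p = Some (str_decode (h a N (LEAST z. R a N z)))"
      using p ex R'_eq by (simp add: C_def \<phi>_def h'_def)
    with d[of p] p(4) show "\<exists>q. U q = Some (str_decode (h a N (LEAST z. R a N z))) \<and>
       length q \<le> a + 1 + (m * a + b) + d" by auto
  qed
qed

end

lemma compressible_strings_nonempty:
  assumes "optimal_machine V"
  shows "compressible_strings V \<noteq> {}"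
proof -
  interpret unary_header 0 0 .
  have "rec_env (\<lambda>e. 2 ^ (2 * e (Suc (Suc 0))) - 1)" "dec_env (\<lambda>e. 0 = (0::nat))"
    by (intro rec_env_intros)+
  from optimal_machine_upper_bound[OF assms, of "\<lambda>a N z. 0 = (0::nat)" "\<lambda>a N z. 2 ^ (2 * a) - 1"] this
  obtain d where d: "\<And>a. \<exists>q. V q = Some (str_decode (2 ^ (2 * a) - 1)) \<and> length q \<le> a + 1 + d"
    by (auto dest: spec[of _ 0])
  \<comment> \<open>The string consists of \<open>2 * a\<close> zeros. For \<open>a = d + 2\<close>
    its length is \<open>2 * d + 4\<close>, one more than the bound for its program.\<close>
  obtain q where q: "V q = Some (str_decode (2 ^ (2 * (d + 2)) - 1))" "length q \<le> d + 2 + 1 + d"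
    using d[of "d + 2"] by blast
  have "strlen (2 ^ (2 * (d + 2)) - 1) = 2 * (d + 2)" by (rule strlen_eqI) auto
  with q have "str_decode (2 ^ (2 * (d + 2)) - 1) \<in> compressible_strings V"
    unfolding compressible_strings_iff by (intro exI[of _ q]) simp
  then show ?thesis by blast
qed

section \<open>Approximating the partition function\<close>

definition weight :: "real \<Rightarrow> nat \<Rightarrow> real" where
  "weight t c = 2 powr (- real (strlen c) / t)"

lemma weight_nonneg: "0 \<le> weight t c" and weight_pos: "0 < weight t c"
  by (simp_all add: weight_def)

lemma weight_1: "weight 1 c = (1/2) ^ strlen c"
  by (simp add: weight_def powr_minus powr_realpow power_one_over inverse_eq_divide)

lemma weight_mono:
  assumes "0 < t" "t \<le> t'"
  shows "weight t c \<le> weight t' c"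
proof -
  have "real (strlen c) / t' \<le> real (strlen c) / t"
    using assms by (intro divide_left_mono) auto
  then show ?thesis by (simp add: weight_def)
qed

text \<open>The integer part of \<open>2\<^sup>P \<cdot> 2\<^bsup>-m/t\<^esup>\<close> for the dyadic rational \<open>t = j / 2\<^sup>n\<close>.\<close>

definition scaled_weight :: "nat \<Rightarrow> nat \<Rightarrow> nat \<Rightarrow> nat \<Rightarrow> nat" where
  "scaled_weight P m n j =
     (\<Sum>y<2 ^ P. if Suc y ^ j * 2 ^ (m * 2 ^ n) \<le> 2 ^ (P * j) then 1 else 0)"

lemma rec_env_scaled_weight:
  assumes "rec_env F" "rec_env G" "rec_env H" "rec_env I"
  shows "rec_env (\<lambda>e. scaled_weight (F e) (G e) (H e) (I e))"
  unfolding scaled_weight_def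
  by (rule rec_env_comp4[OF _ assms]) (intro rec_env_intros)

text \<open>Raised to the power \<open>j\<close>, the comparison of \<open>Suc y\<close> with
  \<open>r\<close> becomes one between integers. The range \<open>y < 2 ^ P\<close> suffices because
  \<open>r \<le> 2 ^ P\<close>.\<close>

lemma scaled_weight_eq_floor:
  assumes "0 < j"
  shows "real (scaled_weight P m n j) = of_int \<lfloor>2 ^ P * 2 powr (- real m / (real j / 2 ^ n))\<rfloor>"
proof -
  define r :: real where "r = 2 ^ P * 2 powr (- real m / (real j / 2 ^ n))"
  have "2 powr (- real m / (real j / 2 ^ n)) \<le> (2::real) powr 0"
    by (intro powr_mono) auto
  then have r: "0 \<le> r" "r \<le> 2 ^ P" by (auto simp: r_def)
  have "r ^ j = 2 ^ (P * j) * (2 powr (- real m / (real j / 2 ^ n))) ^ j"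
    by (simp add: r_def power_mult_distrib power_mult)
  also have "(2 powr (- real m / (real j / 2 ^ n))) ^ j = 2 powr (- real (m * 2 ^ n))"
    using assms by (simp add: powr_realpow[symmetric] powr_powr)
  also have "\<dots> = 1 / 2 ^ (m * 2 ^ n)"
    by (simp add: powr_minus powr_realpow inverse_eq_divide del: of_nat_mult)
  finally have rj: "r ^ j * 2 ^ (m * 2 ^ n) = 2 ^ (P * j)" by simp
  have iff: "Suc y ^ j * 2 ^ (m * 2 ^ n) \<le> 2 ^ (P * j) \<longleftrightarrow> real (Suc y) \<le> r" for y
  proof -
    have "Suc y ^ j * 2 ^ (m * 2 ^ n) \<le> 2 ^ (P * j) \<longleftrightarrow>
        real (Suc y ^ j * 2 ^ (m * 2 ^ n)) \<le> real (2 ^ (P * j))" by (rule of_nat_le_iff[symmetric])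
    also have "\<dots> \<longleftrightarrow> real (Suc y) ^ j * 2 ^ (m * 2 ^ n) \<le> r ^ j * 2 ^ (m * 2 ^ n)"
      by (simp add: rj)
    also have "\<dots> \<longleftrightarrow> real (Suc y) ^ j \<le> r ^ j" by simp
    also have "\<dots> \<longleftrightarrow> real (Suc y) \<le> r"
      using r assms by (intro power_mono_iff) auto
    finally show ?thesis .
  qed
  have nf: "nat \<lfloor>r\<rfloor> \<le> 2 ^ P"
    using r by (metis floor_mono floor_numeral_power nat_le_iff of_nat_numeral of_nat_power)
  have lt: "real (Suc y) \<le> r \<longleftrightarrow> y < nat \<lfloor>r\<rfloor>" for y
    using r by (metis Suc_le_eq le_nat_floor of_nat_floor of_nat_le_iff order_trans)
  have "{y. y < 2 ^ P \<and> real (Suc y) \<le> r} = {..<nat \<lfloor>r\<rfloor>}"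
    unfolding lt by (auto intro: less_le_trans[OF _ nf])
  then have "scaled_weight P m n j = nat \<lfloor>r\<rfloor>"
    unfolding scaled_weight_def iff by (simp add: sum.If_cases Int_def lessThan_def)
  then show ?thesis using r by (simp add: r_def)
qed

text \<open>\<open>A k c\<close> says that the string with code \<open>c\<close> has been listed by
  stage \<open>k\<close>. The last three parameters are the rational approximations that make
  \<open>\<theta>\<close> computable.\<close>

locale enumerated_partition_function =
  fixes A :: "nat \<Rightarrow> nat \<Rightarrow> bool" and T \<theta> :: real and num_pos num_neg den :: "nat \<Rightarrow> nat"
  assumes A_dec: "dec_env (\<lambda>e. A (e 0) (e (Suc 0)))"
    and A_less: "A k c \<Longrightarrow> c < k"
    and A_mono: "A k c \<Longrightarrow> k \<le> k' \<Longrightarrow> A k' c"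
    and kraft: "finite F \<Longrightarrow> F \<subseteq> {c. \<exists>k. A k c} \<Longrightarrow> (\<Sum>c\<in>F. (1/2 :: real) ^ strlen c) \<le> 1/2"
    and nonempty: "\<exists>k c. A k c"
    and T_pos: "0 < T" and T_less: "T < 1"
    and theta: "(weight T has_sum \<theta>) {c. \<exists>k. A k c}"
    and rec_num_den: "total_recursive num_pos" "total_recursive num_neg" "total_recursive den"
    and theta_approx: "n \<ge> 1 \<Longrightarrow>
      \<bar>\<theta> - (real (num_pos n) - real (num_neg n)) / real (den n + 1)\<bar> < 1 / real n"
begin

section \<open>Finite stages of the partition function and their rational approximation\<close>

definition Z :: "nat \<Rightarrow> real \<Rightarrow> real" where
  "Z k t = (\<Sum>c | A k c. weight t c)"

lemma finite_A: "finite {c. A k c}"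
  by (rule finite_subset[of _ "{..<k}"]) (auto dest: A_less)

lemma dec_env_A: "rec_env F \<Longrightarrow> rec_env G \<Longrightarrow> dec_env (\<lambda>e. A (F e) (G e))"
  using rec_env_comp2[of "\<lambda>k c. if A k c then 1 else 0", OF A_dec[unfolded dec_env_def]]
  unfolding dec_env_def .

lemma Z_mono: "0 < t \<Longrightarrow> t \<le> t' \<Longrightarrow> Z k t \<le> Z k t'"
  unfolding Z_def by (intro sum_mono weight_mono)

lemma weight_le_gap:
  assumes "\<exists>k. A k c" "\<not> A k c"
  shows "weight T c \<le> \<theta> - Z k T"
proof -
  have "sum (weight T) (insert c {c. A k c}) \<le> \<theta>"
    using assms finite_A by (intro finite_sum_le_has_sum[OF theta]) (auto simp: weight_nonneg)
  then show ?thesis using assms(2) finite_A by (simp add: Z_def)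
qed

lemma Z_le: "Z k T \<le> \<theta>"
  unfolding Z_def
  using finite_A by (intro finite_sum_le_has_sum[OF theta]) (auto simp: weight_nonneg)

lemma eventually_A:
  assumes "finite F" "F \<subseteq> {c. \<exists>k. A k c}"
  shows "eventually (\<lambda>k. F \<subseteq> {c. A k c}) sequentially"
proof -
  have "eventually (\<lambda>k. \<forall>c\<in>F. A k c) sequentially"
  proof (rule eventually_ball_finite[OF assms(1)], rule ballI)
    fix c assume "c \<in> F"
    then obtain k where "A k c" using assms(2) by blast
    then show "eventually (\<lambda>k. A k c) sequentially"
      using A_mono unfolding eventually_sequentially by blast
  qed
  then show ?thesis by eventually_elim auto
qed

lemma eventually_Z:
  assumes "0 < \<epsilon>"
  shows "eventually (\<lambda>k. \<theta> - \<epsilon> \<le> Z k T) sequentially"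
proof -
  have "\<exists>F. finite F \<and> F \<subseteq> {c. \<exists>k. A k c} \<and> \<theta> - \<epsilon> < sum (weight T) F"
  proof (rule ccontr)
    assume "\<not> ?thesis"
    then have "sum (weight T) F \<le> \<theta> - \<epsilon>" if "finite F" "F \<subseteq> {c. \<exists>k. A k c}" for F
      using that not_less by blast
    then have "\<theta> \<le> \<theta> - \<epsilon>" by (rule has_sum_le_finite_sums[OF theta])
    with assms show False by simp
  qed
  then obtain F where F: "finite F" "F \<subseteq> {c. \<exists>k. A k c}" "\<theta> - \<epsilon> < sum (weight T) F" by blast
  from eventually_A[OF F(1,2)] show ?thesis
  proof eventually_elim
    case (elim k)
    then have "sum (weight T) F \<le> Z k T"
      unfolding Z_def using finite_A by (intro sum_mono2) (auto simp: weight_nonneg)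
    with F(3) show ?case by simp
  qed
qed

text \<open>The scale \<open>4 ^ k\<close> keeps rounding harmless: fewer than \<open>2 ^ k\<close>
  summands each lose at most \<open>1 / 4 ^ k\<close>, in total at most
  \<open>1 / 2 ^ k\<close>.\<close>

definition scaled_Z :: "nat \<Rightarrow> nat \<Rightarrow> nat \<Rightarrow> nat" where
  "scaled_Z k n j = (\<Sum>c<k. if A k c then scaled_weight (2 * k) (strlen c) n j else 0)"

lemma rec_env_scaled_Z:
  assumes "rec_env F" "rec_env G" "rec_env H"
  shows "rec_env (\<lambda>e. scaled_Z (F e) (G e) (H e))"
  unfolding scaled_Z_def
  by (rule rec_env_comp3[OF _ assms])
     (intro rec_env_intros rec_env_scaled_weight rec_env_strlen dec_env_A)

lemma scaled_Z_bounds: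
  assumes "0 < j"
  shows "real (scaled_Z k n j) / 4 ^ k \<le> Z k (real j / 2 ^ n)"
    and "Z k (real j / 2 ^ n) - 1 / 2 ^ k \<le> real (scaled_Z k n j) / 4 ^ k"
proof -
  have A: "{c. A k c} = {..<k} \<inter> {c. A k c}" using A_less by auto
  have sc: "real (scaled_Z k n j) = (\<Sum>c | A k c. real (scaled_weight (2 * k) (strlen c) n j))"
    by (subst A) (simp add: scaled_Z_def sum.If_cases)
  have fl: "real (scaled_weight (2 * k) (strlen c) n j) \<le> 4 ^ k * weight (real j / 2 ^ n) c"
    "4 ^ k * weight (real j / 2 ^ n) c \<le> real (scaled_weight (2 * k) (strlen c) n j) + 1" for c
    using scaled_weight_eq_floor[OF assms, of "2 * k" "strlen c" n]
      of_int_floor_le[of "2 ^ (2 * k) * 2 powr (- real (strlen c) / (real j / 2 ^ n))"]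
      real_of_int_floor_add_one_ge[of "2 ^ (2 * k) * 2 powr (- real (strlen c) / (real j / 2 ^ n))"]
    by (simp_all add: weight_def power_mult)
  have "real (scaled_Z k n j) \<le> 4 ^ k * Z k (real j / 2 ^ n)"
    unfolding sc Z_def sum_distrib_left by (intro sum_mono fl)
  then show "real (scaled_Z k n j) / 4 ^ k \<le> Z k (real j / 2 ^ n)"
    by (simp add: field_simps)
  have "4 ^ k * Z k (real j / 2 ^ n) \<le>
      (\<Sum>c | A k c. real (scaled_weight (2 * k) (strlen c) n j) + 1)"
    unfolding Z_def sum_distrib_left by (intro sum_mono fl)
  also have "\<dots> = real (scaled_Z k n j) + real (card {c. A k c})"
    by (simp add: sc sum.distrib)
  also have "real (card {c. A k c}) \<le> 2 ^ k"
  proof -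
    have "card {c. A k c} \<le> card {..<k}" by (intro card_mono) (auto dest: A_less)
    also have "\<dots> < 2 ^ k" by simp
    finally show ?thesis by (metis less_imp_le of_nat_le_iff of_nat_numeral of_nat_power)
  qed
  finally have "4 ^ k * Z k (real j / 2 ^ n) \<le> real (scaled_Z k n j) + 2 ^ k" by simp
  then have "Z k (real j / 2 ^ n) \<le> (real (scaled_Z k n j) + 2 ^ k) / 4 ^ k"
    by (simp add: field_simps)
  also have "\<dots> = real (scaled_Z k n j) / 4 ^ k + 1 / 2 ^ k"
    by (simp add: add_divide_distrib power_divide[symmetric] flip: power_one_over)
  finally show "Z k (real j / 2 ^ n) - 1 / 2 ^ k \<le> real (scaled_Z k n j) / 4 ^ k" by simp
qed

text \<open>Denominator-free form of \<open>scaled_Z k n j / 4\<^sup>k > \<theta>\<^sub>n - 4 / 2\<^sup>n\<close>, where \<open>\<theta>\<^sub>n\<close> is the rational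
  approximation of \<open>\<theta>\<close> to within \<open>2\<^bsup>-n\<^esup>\<close>.\<close>

definition good :: "nat \<Rightarrow> nat \<Rightarrow> nat \<Rightarrow> bool" where
  "good n j k \<longleftrightarrow> n \<le> k \<and> num_pos (2 ^ n) * 4 ^ k * 2 ^ n <
     scaled_Z k n j * (den (2 ^ n) + 1) * 2 ^ n + num_neg (2 ^ n) * 4 ^ k * 2 ^ n
       + 4 * (den (2 ^ n) + 1) * 4 ^ k"

lemma dec_env_good:
  assumes "rec_env F" "rec_env G" "rec_env H"
  shows "dec_env (\<lambda>e. good (F e) (G e) (H e))"
proof -
  have "dec_env (\<lambda>e. good (e 0) (e (Suc 0)) (e (Suc (Suc 0))))"
    unfolding good_def
    by (intro rec_env_intros rec_env_scaled_Z rec_num_den[THEN rec_env_total_recursive])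
  then show ?thesis
    using rec_env_comp3[of "\<lambda>n j k. if good n j k then 1 else 0", OF _ assms]
    unfolding dec_env_def by blast
qed

lemma good_iff:
  "good n j k \<longleftrightarrow> n \<le> k \<and>
     (real (num_pos (2 ^ n)) - real (num_neg (2 ^ n))) / real (den (2 ^ n) + 1) - 4 / 2 ^ n
       < real (scaled_Z k n j) / 4 ^ k"
proof -
  define p where "p = real (num_pos (2 ^ n))"
  define m where "m = real (num_neg (2 ^ n))"
  define d where "d = real (den (2 ^ n) + 1)"
  define s where "s = real (scaled_Z k n j)"
  have d: "0 < d" by (simp add: d_def)
  have "num_pos (2 ^ n) * 4 ^ k * 2 ^ n <
     scaled_Z k n j * (den (2 ^ n) + 1) * 2 ^ n + num_neg (2 ^ n) * 4 ^ k * 2 ^ n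
       + 4 * (den (2 ^ n) + 1) * 4 ^ k \<longleftrightarrow>
     real (num_pos (2 ^ n) * 4 ^ k * 2 ^ n) <
     real (scaled_Z k n j * (den (2 ^ n) + 1) * 2 ^ n + num_neg (2 ^ n) * 4 ^ k * 2 ^ n
       + 4 * (den (2 ^ n) + 1) * 4 ^ k)" by (rule of_nat_less_iff[symmetric])
  also have "\<dots> \<longleftrightarrow> p * 4 ^ k * 2 ^ n < s * d * 2 ^ n + m * 4 ^ k * 2 ^ n + 4 * d * 4 ^ k"
    by (simp only: p_def m_def d_def s_def of_nat_add of_nat_mult of_nat_power of_nat_numeral)
  also have "\<dots> \<longleftrightarrow> (p - m) / d - 4 / 2 ^ n < s / 4 ^ k"
  proof -
    have "s / 4 ^ k - ((p - m) / d - 4 / 2 ^ n) =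
        (s * d * 2 ^ n + m * 4 ^ k * 2 ^ n + 4 * d * 4 ^ k - p * 4 ^ k * 2 ^ n) / (4 ^ k * d * 2 ^ n)"
      using d by (simp add: field_simps)
    moreover have "0 < 4 ^ k * d * 2 ^ n" using d by simp
    ultimately have "0 < s / 4 ^ k - ((p - m) / d - 4 / 2 ^ n) \<longleftrightarrow>
        0 < s * d * 2 ^ n + m * 4 ^ k * 2 ^ n + 4 * d * 4 ^ k - p * 4 ^ k * 2 ^ n"
      by (simp add: zero_less_divide_iff)
    then show ?thesis by linarith
  qed
  finally show ?thesis by (simp add: good_def p_def m_def d_def s_def)
qed

lemma theta_approx_dyadic:
  "\<bar>\<theta> - (real (num_pos (2 ^ n)) - real (num_neg (2 ^ n))) / real (den (2 ^ n) + 1)\<bar> < 1 / 2 ^ n"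
  using theta_approx[of "2 ^ n"] by simp

text \<open>The \<open>5\<close> is the \<open>4\<close> from \<open>good\<close> plus
  \<open>1\<close> for the approximation of \<open>\<theta>\<close>; the weights are rounded down,
  which costs nothing here.\<close>

lemma good_imp_Z_ge:
  assumes "good n j k" "0 < j"
  shows "\<theta> - 5 / 2 ^ n < Z k (real j / 2 ^ n)"
proof -
  have "(5::real) / 2 ^ n = 4 / 2 ^ n + 1 / 2 ^ n" by (simp add: add_divide_distrib[symmetric])
  then show ?thesis
    using assms scaled_Z_bounds(1)[of j k n] theta_approx_dyadic[of n] unfolding good_iff by linarith
qed

text \<open>The gap of \<open>Z k T\<close>, the rounding error and the approximation of
  \<open>\<theta>\<close> lose at most \<open>1 / 2 ^ n\<close> each, so the margin
  \<open>4 / 2 ^ n\<close> in \<open>good\<close> leaves room for strictness.\<close>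

lemma goodI:
  assumes "T \<le> real j / 2 ^ n" "\<theta> - 1 / 2 ^ n \<le> Z k T" "n \<le> k"
  shows "good n j k"
proof -
  have "0 < real j / 2 ^ n" using assms(1) T_pos by linarith
  then have j: "0 < j" by (simp add: zero_less_divide_iff)
  have "Z k T \<le> Z k (real j / 2 ^ n)" using assms(1) T_pos by (intro Z_mono)
  moreover have "1 / 2 ^ k \<le> (1::real) / 2 ^ n" using assms(3)
    by (intro divide_left_mono) (auto intro: power_increasing)
  moreover have "(4::real) / 2 ^ n = 1 / 2 ^ n + 1 / 2 ^ n + 1 / 2 ^ n + 1 / 2 ^ n"
    by (simp add: add_divide_distrib[symmetric])
  moreover have "(0::real) < 1 / 2 ^ n" by simp
  ultimately show ?thesis unfolding good_iff
    using assms(2,3) scaled_Z_bounds(2)[OF j, of k n] theta_approx_dyadic[of n] by linarith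
qed

lemma eventually_good:
  assumes "T \<le> real j / 2 ^ n"
  shows "eventually (good n j) sequentially"
  using eventually_Z[of "1 / 2 ^ n", simplified] eventually_ge_at_top[of n]
  by eventually_elim (rule goodI[OF assms])

section \<open>Randomness\<close>

text \<open>The weights at \<open>T\<close> and \<open>t\<close> differ by the factor
  \<open>exp (- x)\<close>, and \<open>1 - exp (- x) \<le> x\<close> is linear in
  \<open>t - T\<close> but also in the length. As \<open>(1 + T) / 2 < 1\<close>, the weight at
  \<open>t\<close> is smaller than \<open>(1/2) ^ strlen c\<close> by a factor exponential in the
  length, which absorbs the linear one.\<close>

lemma weight_Lipschitz:
  assumes t: "T \<le> t" "t \<le> (1 + T) / 2"
  defines "\<beta> \<equiv> 2 / (1 + T) - 1"
  shows "weight t c \<le> weight T c + (t - T) / (\<beta> * T\<^sup>2) * (1/2) ^ strlen c"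
proof -
  define m where "m = real (strlen c)"
  have m: "0 \<le> m" by (simp add: m_def)
  have \<beta>: "0 < \<beta>" using T_pos T_less by (simp add: \<beta>_def field_simps)
  define x where "x = m * (1 / T - 1 / t) * ln 2"
  have "weight T c = weight t c * exp (- x)"
    using T_pos t by (simp add: weight_def powr_def x_def m_def exp_add[symmetric] field_simps)
  moreover have "1 - exp (- x) \<le> x" using exp_ge_add_one_self[of "- x"] by linarith
  ultimately have "weight t c - weight T c \<le> weight t c * x"
    using weight_nonneg[of t c] by (metis mult_left_mono mult.right_neutral right_diff_distrib)
  also have "weight t c * x \<le> weight t c * (m * ((t - T) / T\<^sup>2) * ln 2)"
  proof (rule mult_left_mono[OF _ weight_nonneg])
    have "1 / T - 1 / t = (t - T) / (T * t)" using T_pos t by (simp add: field_simps)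
    also have "\<dots> \<le> (t - T) / T\<^sup>2"
      using T_pos t by (intro divide_left_mono) (auto simp: power2_eq_square)
    finally show "x \<le> m * ((t - T) / T\<^sup>2) * ln 2" unfolding x_def using m by (intro mult_right_mono mult_left_mono) auto
  qed
  also have "weight t c * (m * ((t - T) / T\<^sup>2) * ln 2) \<le>
      weight ((1 + T) / 2) c * (m * ((t - T) / T\<^sup>2) * ln 2)"
    using T_pos t m by (intro mult_right_mono weight_mono) auto
  also have "weight ((1 + T) / 2) c = (1/2) ^ strlen c * exp (- (m * \<beta> * ln 2))"
  proof -
    have "weight ((1 + T) / 2) c = exp (- (m * (\<beta> + 1) * ln 2))"
      by (simp add: weight_def powr_def \<beta>_def m_def)
    also have "\<dots> = weight 1 c * exp (- (m * \<beta> * ln 2))"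
      by (simp add: weight_def powr_def m_def exp_add[symmetric] algebra_simps)
    finally show ?thesis by (simp add: weight_1)
  qed
  also have "\<dots> * (m * ((t - T) / T\<^sup>2) * ln 2) =
      (1/2) ^ strlen c * ((t - T) / (\<beta> * T\<^sup>2)) * (m * \<beta> * ln 2 * exp (- (m * \<beta> * ln 2)))"
    using \<beta> by simp
  also have "\<dots> \<le> (1/2) ^ strlen c * ((t - T) / (\<beta> * T\<^sup>2)) * 1"
  proof (rule mult_left_mono)
    have "m * \<beta> * ln 2 \<le> exp (m * \<beta> * ln 2)" using exp_ge_add_one_self[of "m * \<beta> * ln 2"] by linarith
    then show "m * \<beta> * ln 2 * exp (- (m * \<beta> * ln 2)) \<le> 1" by (simp add: exp_minus field_simps)
    show "0 \<le> (1/2) ^ strlen c * ((t - T) / (\<beta> * T\<^sup>2))" using t \<beta> by simp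
  qed
  finally show ?thesis by (simp add: algebra_simps)
qed

text \<open>The termwise bounds are summed by Kraft's inequality, which makes the constant
  independent of the stage.\<close>

lemma Z_Lipschitz:
  "\<exists>L\<ge>0. \<forall>t k. T \<le> t \<longrightarrow> t \<le> (1 + T) / 2 \<longrightarrow> Z k t \<le> Z k T + L * (t - T)"
proof -
  define \<beta> where "\<beta> = 2 / (1 + T) - 1"
  have \<beta>: "0 < \<beta>" using T_pos T_less by (simp add: \<beta>_def field_simps)
  have "Z k t \<le> Z k T + 1 / (\<beta> * T\<^sup>2) * (t - T)" if t: "T \<le> t" "t \<le> (1 + T) / 2" for t k
  proof -
    have "Z k t \<le> (\<Sum>c | A k c. weight T c + (t - T) / (\<beta> * T\<^sup>2) * (1/2) ^ strlen c)"
      unfolding Z_def \<beta>_def by (intro sum_mono weight_Lipschitz t)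
    also have "\<dots> = Z k T + (t - T) / (\<beta> * T\<^sup>2) * (\<Sum>c | A k c. (1/2) ^ strlen c)"
      by (simp add: Z_def sum.distrib sum_distrib_left)
    also have "\<dots> \<le> Z k T + (t - T) / (\<beta> * T\<^sup>2) * 1"
    proof (intro add_left_mono mult_left_mono)
      have "(\<Sum>c | A k c. (1/2 :: real) ^ strlen c) \<le> 1/2" by (rule kraft[OF finite_A]) auto
      then show "(\<Sum>c | A k c. (1/2 :: real) ^ strlen c) \<le> 1" by simp
      show "0 \<le> (t - T) / (\<beta> * T\<^sup>2)" using t \<beta> by simp
    qed
    finally show ?thesis by simp
  qed
  moreover have "0 \<le> 1 / (\<beta> * T\<^sup>2)" using \<beta> by simp
  ultimately show ?thesis by blast
qed

text \<open>\<open>J / 2 ^ n\<close> is \<open>T\<close> cut to \<open>n\<close> bits and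
  \<open>t\<close> is the next grid point; the first hypothesis keeps \<open>t\<close> in the
  Lipschitz range. A missing element then weighs less than \<open>(5 + L) / 2 ^ n\<close>, and
  taking logarithms bounds its length.\<close>

lemma unlisted_long:
  "\<exists>b::nat. \<forall>n J k c. 1 / 2 ^ n \<le> (1 - T) / 2 \<longrightarrow> real J \<le> 2 ^ n * T \<longrightarrow> 2 ^ n * T < real J + 1 \<longrightarrow>
     good n (Suc J) k \<longrightarrow> (\<exists>k. A k c) \<longrightarrow> \<not> A k c \<longrightarrow> T * real n - real b < real (strlen c)"
proof -
  obtain L where L: "L \<ge> 0" "\<And>t k. T \<le> t \<Longrightarrow> t \<le> (1 + T) / 2 \<Longrightarrow> Z k t \<le> Z k T + L * (t - T)"
    using Z_Lipschitz by blast
  obtain b :: nat where b: "T * log 2 (5 + L) \<le> real b" using real_arch_simple by blast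
  show ?thesis
  proof (intro exI[of _ b] allI impI)
    fix n J k c
    assume n: "1 / 2 ^ n \<le> (1 - T) / 2" and J: "real J \<le> 2 ^ n * T" "2 ^ n * T < real J + 1"
      and g: "good n (Suc J) k" and c: "\<exists>k. A k c" "\<not> A k c"
    define t where "t = real (Suc J) / 2 ^ n"
    have t: "T \<le> t" "t - T \<le> 1 / 2 ^ n" using J by (simp_all add: t_def field_simps)
    have "t \<le> (1 + T) / 2" using order_trans[OF t(2) n] by (simp add: field_simps)
    then have "Z k t \<le> Z k T + L * (1 / 2 ^ n)"
      using L(2)[of t k] t mult_left_mono[OF t(2) L(1)] by linarith
    moreover have "\<theta> - 5 / 2 ^ n < Z k t" unfolding t_def by (rule good_imp_Z_ge[OF g]) simp
    ultimately have "weight T c < 5 / 2 ^ n + L * (1 / 2 ^ n)"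
      using weight_le_gap[OF c] by linarith
    also have "\<dots> = 2 powr (log 2 (5 + L) - real n)"
      using L(1) by (simp add: powr_diff powr_realpow add_divide_distrib)
    finally have "- real (strlen c) / T < log 2 (5 + L) - real n"
      by (simp add: weight_def)
    then have "T * real n - T * log 2 (5 + L) < real (strlen c)"
      using T_pos by (simp add: field_simps)
    with b show "T * real n - real b < real (strlen c)" by linarith
  qed
qed

text \<open>Otherwise all \<open>2 ^ l\<close> strings of length \<open>l\<close> would be listed,
  with sum \<open>1\<close> instead of at most \<open>1/2\<close>.\<close>

lemma ex_incompressible: "\<exists>c. strlen c = l \<and> (\<forall>k. \<not> A k c)"
proof (rule ccontr)
  assume "\<not> ?thesis"
  moreover define I :: "nat set" where "I = {2 ^ l - 1..<2 ^ Suc l - 1}"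
  moreover have len: "strlen c = l" if "c \<in> I" for c
    using that unfolding I_def by (intro strlen_eqI) auto
  ultimately have "(\<Sum>c\<in>I. (1/2 :: real) ^ strlen c) \<le> 1/2"
    by (intro kraft) auto
  also have "(\<Sum>c\<in>I. (1/2 :: real) ^ strlen c) = (\<Sum>c\<in>I. (1/2) ^ l)"
    by (rule sum.cong) (auto simp: len)
  also have "\<dots> = real (2 ^ Suc l - 1 - (2 ^ l - 1)) * (1/2) ^ l" by (simp add: I_def)
  also have "2 ^ Suc l - 1 - (2 ^ l - 1) = (2 ^ l :: nat)" by simp
  also have "real (2 ^ l) * (1/2) ^ l = 1" by (simp add: power_one_over)
  finally show False by simp
qed

end

lemma le_HcI:
  assumes "\<And>q. U q = Some s \<Longrightarrow> r \<le> real (length q)"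
  shows "ereal r \<le> ereal_of_enat (Hc U s)"
proof (cases "Hc U s")
  case (enat m)
  then have "Hc U s < enat (Suc m)" by simp
  then obtain q where "U q = Some s" "length q < Suc m"
    unfolding Hc_def by (auto simp: INF_less_iff)
  with assms[of q] enat show ?thesis by simp
qed simp

lemma str_code_prefix_bits:
  assumes "0 < T" "T < 1"
  shows "Suc (str_code (prefix_bits T n)) = 2 ^ n + nat \<lfloor>2 ^ n * T\<rfloor>"
proof -
  have "frac T = T" using assms by (simp add: frac_eq)
  then show ?thesis using Suc_str_code_prefix_bits[of T n] by simp
qed

lemma length_prefix_bits [simp]: "length (prefix_bits x n) = n"
  by (simp add: prefix_bits_def)

context enumerated_partition_function
begin

text \<open>From the bits \<open>w\<close> one computes \<open>h w k\<close>, a string of length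
  just below \<open>T * n - b\<close> missing from stage \<open>k\<close>. By
  \<open>unlisted_long\<close> it is too short to be listed later, so its complexity is at least its
  length.\<close>

lemma weakly_random:
  assumes U: "optimal_machine U" and V: "optimal_machine V"
    and A: "\<And>c. str_decode c \<in> compressible_strings V \<longleftrightarrow> (\<exists>k. A k c)"
  shows "weakly_Chaitin_random U T T"
proof -
  obtain b :: nat where b: "\<And>n J k c. 1 / 2 ^ n \<le> (1 - T) / 2 \<Longrightarrow> real J \<le> 2 ^ n * T \<Longrightarrow>
     2 ^ n * T < real J + 1 \<Longrightarrow> good n (Suc J) k \<Longrightarrow> (\<exists>k. A k c) \<Longrightarrow> \<not> A k c \<Longrightarrow>
     T * real n - real b < real (strlen c)"
    using unlisted_long by blast
  obtain n0 :: nat where n0: "(1/2) ^ n0 < (1 - T) / 2"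
    using real_arch_pow_inv[of "(1 - T) / 2" "1/2"] T_less by auto
  define val where "val w = Suc w - 2 ^ strlen w" for w
  \<comment> \<open>The length must be computed from \<open>w\<close>, so \<open>T\<close> is
    replaced by \<open>J / 2 ^ n\<close>. This costs at most \<open>n / 2 ^ n \<le> 1\<close>, and
    the division at most \<open>1\<close> more.\<close>
  define len where "len w = strlen w * val w div 2 ^ strlen w - b" for w
  define R where "R w k \<longleftrightarrow> good (strlen w) (Suc (val w)) k" for w k
  define h where "h w k = bounded_least (2 ^ Suc (len w)) (\<lambda>c. strlen c = len w \<and> \<not> A k c)" for w k
  have val: "rec_env (\<lambda>e. val (G e))" if "rec_env G" for G
    unfolding val_def using that by (intro rec_env_intros rec_env_strlen)
  have len: "rec_env (\<lambda>e. len (G e))" if "rec_env G" for G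
    unfolding len_def using that by (intro rec_env_intros rec_env_strlen val)
  have "dec_env (\<lambda>e. R (e (Suc 0)) (e 0))"
    unfolding R_def by (intro dec_env_good rec_env_Suc val rec_env_strlen rec_env_var)
  moreover have "rec_env (\<lambda>e. h (e (Suc 0)) (e 0))"
    unfolding h_def by (intro rec_env_intros rec_env_strlen len dec_env_A)
  ultimately obtain d where d: "\<And>q w. U q = Some w \<Longrightarrow> eventually (R (str_code w)) sequentially \<Longrightarrow>
    \<exists>z q'. R (str_code w) z \<and> V q' = Some (str_decode (h (str_code w) z)) \<and> length q' \<le> length q + d"
    using optimal_machine_image[OF V, of U R h] U unfolding optimal_machine_def by blast
  have h: "strlen (h w k) = len w \<and> \<not> A k (h w k)" for w k
  proof -
    obtain c where c: "strlen c = len w" "\<not> A k c" using ex_incompressible by blast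
    then have ex: "\<exists>c<2 ^ Suc (len w). strlen c = len w \<and> \<not> A k c"
      using strlen_bounds(2)[of c] by (intro exI[of _ c]) simp
    show ?thesis unfolding h_def bounded_least_eq[OF ex]
      using ex by (intro LeastI_ex[of "\<lambda>c. strlen c = len w \<and> \<not> A k c"]) blast
  qed
  have main: "T * real n - real (b + d + 2) \<le> real (length q)"
    if n: "n0 \<le> n" and q: "U q = Some (prefix_bits T n)" for n q
  proof -
    define w where "w = str_code (prefix_bits T n)"
    define J where "J = nat \<lfloor>2 ^ n * T\<rfloor>"
    have sw: "strlen w = n" by (simp add: w_def)
    have vw: "val w = J"
      using str_code_prefix_bits[OF T_pos T_less, of n] by (simp add: val_def sw) (simp add: w_def J_def)
    have J: "real J \<le> 2 ^ n * T" "2 ^ n * T < real J + 1"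
      using T_pos by (simp_all add: J_def)
    have "(1/2 :: real) ^ n \<le> (1/2) ^ n0" using n by (intro power_decreasing) auto
    then have small: "1 / 2 ^ n \<le> (1 - T) / 2" using n0 by (simp add: power_one_over)
    have "eventually (R w) sequentially"
      unfolding R_def sw vw using J by (intro eventually_good) (simp add: field_simps)
    then obtain k q' where k: "R w k" and q': "V q' = Some (str_decode (h w k))"
        "length q' \<le> length q + d"
      using d[OF q] unfolding w_def by blast
    have "length q' \<ge> len w"
    proof (rule ccontr)
      assume "\<not> len w \<le> length q'"
      then have lt: "length q' < length (str_decode (h w k))" using h[of w k] by simp
      then have "str_decode (h w k) \<in> compressible_strings V"
        using q' unfolding compressible_strings_iff by blast
      then have "T * real n - real b < real (len w)"
        using b[OF small J, of k "h w k"] k h[of w k] A by (simp add: R_def sw vw)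
      \<comment> \<open>If \<open>len w = 0\<close>, truncated subtraction may spoil this bound, but
        then no program is shorter than the string.\<close>
      moreover have "real (len w) \<le> T * real n - real b" if "len w \<noteq> 0"
      proof -
        have "real (len w) = real (n * J div 2 ^ n) - real b"
          using that unfolding len_def sw vw by simp
        also have "real (n * J div 2 ^ n) \<le> real (n * J) / 2 ^ n"
          using of_nat_div_le_of_nat[of "n * J" "2 ^ n", where ?'a = real] by simp
        also have "\<dots> \<le> real n * (2 ^ n * T) / 2 ^ n"
          using J by (intro divide_right_mono) (auto intro: mult_left_mono)
        finally show ?thesis by (simp add: mult.commute)
      qed
      ultimately show False using lt h[of w k] by fastforce
    qed
    moreover have "T * real n - real b - 2 \<le> real (len w)"
    proof -
      have "real n \<le> 2 ^ n" using less_exp[of n] by (metis less_imp_le of_nat_le_iff of_nat_numeral of_nat_power)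
      then have "real n * (2 ^ n * T - real J) \<le> 2 ^ n * 1"
        using J by (intro mult_mono) auto
      then have "real n * T - real (n * J) / 2 ^ n \<le> 1" by (simp add: field_simps)
      moreover have "real (n * J) / 2 ^ n - 1 \<le> real (n * J div 2 ^ n)"
        using floor_divide_of_nat_eq[of "n * J" "2 ^ n", where ?'a = real]
          real_of_int_floor_ge_diff_one[of "real (n * J) / 2 ^ n"] by simp
      ultimately show ?thesis unfolding len_def sw vw by (simp add: mult.commute) 
    qed
    ultimately show ?thesis using q'(2) by simp
  qed
  show ?thesis
    unfolding weakly_Chaitin_random_def
  \<comment> \<open>The summand \<open>n0\<close> takes care of \<open>n < n0\<close>, where the
    left side is not positive.\<close>
  proof (intro exI[of _ "n0 + b + d + 2"] allI impI le_HcI)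
    fix n :: nat and q assume q: "U q = Some (prefix_bits T n)"
    show "T * real n - real (n0 + b + d + 2) \<le> real (length q)"
    proof (cases "n0 \<le> n")
      case True
      then show ?thesis using main[OF True q] by simp
    next
      case False
      then have "T * real n \<le> 1 * real n0" using T_pos T_less by (intro mult_mono) auto
      then show ?thesis by simp
    qed
  qed
qed

end

section \<open>Compressibility\<close>

lemma strlen_le: "strlen c \<le> c"
  using strlen_bounds(1)[of c] less_exp[of "strlen c"] by linarith

text \<open>One listed string already makes \<open>Z k\<close> fall at a linear rate below
  \<open>T\<close>, and the other terms do not grow. Kraft's bound excludes the empty string, whose
  weight would not change.\<close>

lemma (in enumerated_partition_function) Z_gap:
  assumes A: "A k c" and t: "0 < t" "t \<le> T"
  shows "Z k t \<le> Z k T - weight T c * ((T - t) / 4)"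
proof -
  define y where "y = T - t"
  have y: "0 \<le> y" "y \<le> 1" using t T_less by (auto simp: y_def)
  have "(\<Sum>c\<in>{c}. (1/2 :: real) ^ strlen c) \<le> 1/2" using A by (intro kraft) auto
  then have s: "1 \<le> strlen c" by (cases "strlen c") auto
  define x where "x = real (strlen c) * (1 / t - 1 / T) * ln 2"
  have w: "weight t c = weight T c * exp (- x)"
    using T_pos t by (simp add: weight_def powr_def x_def exp_add[symmetric] field_simps)
  have "2 / 3 * y \<le> x"
  proof -
    have "t * T \<le> 1 * 1" using t T_pos T_less by (intro mult_mono) auto
    then have "y / 1 \<le> y / (t * T)" using y t T_pos by (intro divide_left_mono) auto
    also have "y / (t * T) = 1 / t - 1 / T" using t T_pos by (simp add: y_def field_simps)
    finally have "y \<le> 1 / t - 1 / T" by simp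
    then have "1 * y \<le> real (strlen c) * (1 / t - 1 / T)" using s y by (intro mult_mono) auto
    then have "y * (2 / 3) \<le> x" unfolding x_def using y ln2_ge_two_thirds by (intro mult_mono) auto
    then show ?thesis by simp
  qed
  then have "exp (- x) \<le> exp (- (2 / 3 * y))" by simp
  also have "\<dots> \<le> 1 / (1 + 2 / 3 * y)"
    using exp_ge_add_one_self[of "2 / 3 * y"] y
    by (simp add: exp_minus inverse_eq_divide divide_left_mono)
  also have "\<dots> \<le> 1 - y / 4"
  proof -
    have "y * y \<le> 1 * y" using y by (intro mult_right_mono) auto
    then show ?thesis using y by (simp add: field_simps)
  qed
  finally have "weight t c \<le> weight T c * (1 - y / 4)"
    unfolding w using weight_nonneg by (intro mult_left_mono)
  moreover have "(\<Sum>c\<in>{c. A k c} - {c}. weight t c) \<le> (\<Sum>c\<in>{c. A k c} - {c}. weight T c)"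
    using t by (intro sum_mono weight_mono)
  moreover have "Z k t' = weight t' c + (\<Sum>c\<in>{c. A k c} - {c}. weight t' c)" for t'
    unfolding Z_def using A finite_A by (simp add: sum.remove)
  ultimately show ?thesis by (simp add: y_def algebra_simps)
qed

text \<open>\<open>M / K\<close> is a rational upper bound for \<open>T\<close>. To find \<open>K a\<close> bits of \<open>T\<close> one needs a stage after
  which no string of length at most \<open>M a\<close> is enumerated and the longer ones contribute less than
  \<open>2\<^bsup>-K a\<^esup>\<close>. Both requirements are read off a single quantity of size at most \<open>2\<^bsup>M a\<^esup>\<close>, the sum of
  \<open>progress a c\<close> over the strings enumerated so far; \<open>M a\<close> bits are enough to specify its limit up
  to \<open>1\<close>.\<close>

locale rational_upper_bound = enumerated_partition_function +
  fixes K M :: nat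
  assumes M_pos: "0 < M" and M_le: "M \<le> K" and T_le: "real K * T \<le> real M"
begin

text \<open>The exponent is at most \<open>strlen c / T\<close> because
  \<open>K * T \<le> M\<close>, so a long string has weight at most
  \<open>progress a c / 2 ^ (K * a)\<close>. Powers of two keep the totals exactly
  computable.\<close>

definition progress :: "nat \<Rightarrow> nat \<Rightarrow> real" where
  "progress a c = (if strlen c \<le> M * a then 1 else 2 ^ (K * a) / 2 ^ (strlen c * K div M))"

definition total_progress :: "nat \<Rightarrow> nat \<Rightarrow> real" where
  "total_progress a k = (\<Sum>c | A k c. progress a c)"

text \<open>The integer form of \<open>N < total_progress a k\<close>: listed strings have length
  below \<open>k\<close>, so the factor \<open>2 ^ (K * k)\<close> clears all denominators.\<close>

definition reached :: "nat \<Rightarrow> nat \<Rightarrow> nat \<Rightarrow> bool" where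
  "reached a N k \<longleftrightarrow> N * 2 ^ (K * k) < (\<Sum>c<k. if A k c then
     (if strlen c \<le> M * a then 2 ^ (K * k) else 2 ^ (K * a + K * k - strlen c * K div M)) else 0)"

lemma progress_pos: "0 < progress a c"
  by (simp add: progress_def)

lemma dec_env_reached:
  assumes "rec_env F" "rec_env G" "rec_env H"
  shows "dec_env (\<lambda>e. reached (F e) (G e) (H e))"
proof -
  have "dec_env (\<lambda>e. reached (e 0) (e (Suc 0)) (e (Suc (Suc 0))))"
    unfolding reached_def by (intro rec_env_intros rec_env_strlen dec_env_A)
  then show ?thesis
    using rec_env_comp3[of "\<lambda>a N k. if reached a N k then 1 else 0", OF _ assms]
    unfolding dec_env_def by blast
qed

lemma reached_iff: "reached a N k \<longleftrightarrow> real N < total_progress a k"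
proof -
  define f :: "nat \<Rightarrow> nat" where
    "f c = (if strlen c \<le> M * a then 2 ^ (K * k) else 2 ^ (K * a + K * k - strlen c * K div M))" for c
  have f: "real (f c) = 2 ^ (K * k) * progress a c" if "A k c" for c
  proof -
    have "strlen c * K div M \<le> strlen c * K" by simp
    also have "\<dots> \<le> k * K" using strlen_le[of c] A_less[OF that] by simp
    finally have "strlen c * K div M \<le> K * a + K * k" by (simp add: mult.commute)
    then have "real (2 ^ (K * a + K * k - strlen c * K div M)) =
        2 ^ (K * a + K * k) / 2 ^ (strlen c * K div M)"
      by (simp only: of_nat_power of_nat_numeral) (simp add: power_diff)
    then show ?thesis by (simp add: f_def progress_def power_add)
  qed
  have A: "{c. A k c} = {..<k} \<inter> {c. A k c}" using A_less by auto
  have "real (\<Sum>c<k. if A k c then f c else 0) = (\<Sum>c | A k c. real (f c))"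
    by (subst A) (simp add: sum.If_cases)
  also have "\<dots> = 2 ^ (K * k) * total_progress a k"
    by (simp add: f total_progress_def sum_distrib_left)
  finally have *: "real (\<Sum>c<k. if A k c then f c else 0) = 2 ^ (K * k) * total_progress a k" .
  have "reached a N k \<longleftrightarrow> N * 2 ^ (K * k) < (\<Sum>c<k. if A k c then f c else 0)"
    unfolding reached_def f_def by (rule refl)
  also have "\<dots> \<longleftrightarrow> real (N * 2 ^ (K * k)) < real (\<Sum>c<k. if A k c then f c else 0)"
    by (rule of_nat_less_iff[symmetric])
  also have "\<dots> \<longleftrightarrow> real N * 2 ^ (K * k) < total_progress a k * 2 ^ (K * k)"
    unfolding * by (simp add: mult.commute)
  also have "\<dots> \<longleftrightarrow> real N < total_progress a k" by simp
  finally show ?thesis .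
qed

text \<open>At length \<open>M * a + r\<close> with \<open>r > 0\<close> the value is
  \<open>1 / 2 ^ (r * K div M)\<close>, and \<open>M \<le> K\<close> makes this at most
  \<open>1 / 2 ^ r\<close>.\<close>

lemma progress_le: "progress a c \<le> 2 ^ (M * a) * (1/2) ^ strlen c"
proof (cases "strlen c \<le> M * a")
  case True
  then have "(2::real) ^ strlen c \<le> 2 ^ (M * a)" by (intro power_increasing) auto
  then show ?thesis using True by (simp add: progress_def power_one_over field_simps)
next
  case False
  then obtain r where r: "strlen c = M * a + r" by (metis le_add_diff_inverse nat_le_linear)
  have "strlen c * K div M = (K * a * M + r * K) div M" by (simp add: r algebra_simps)
  also have "\<dots> = K * a + r * K div M" using M_pos by simp
  finally have eq: "strlen c * K div M = K * a + r * K div M" .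
  have "r = r * M div M" using M_pos by simp
  also have "\<dots> \<le> r * K div M" using M_le by (intro div_le_mono) simp
  finally have "(2::real) ^ r \<le> 2 ^ (r * K div M)" by (intro power_increasing) auto
  then have "1 / 2 ^ (r * K div M) \<le> (1::real) / 2 ^ r" by (intro divide_left_mono) auto
  then show ?thesis using False
    by (simp add: progress_def eq power_add) (simp add: r power_add power_one_over)
qed

lemma sum_progress_le:
  assumes "finite F" "F \<subseteq> {c. \<exists>k. A k c}"
  shows "sum (progress a) F < 2 ^ (M * a)"
proof -
  have "sum (progress a) F \<le> (\<Sum>c\<in>F. 2 ^ (M * a) * (1/2) ^ strlen c)"
    by (intro sum_mono progress_le)
  also have "\<dots> = 2 ^ (M * a) * (\<Sum>c\<in>F. (1/2) ^ strlen c)" by (simp add: sum_distrib_left)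
  also have "\<dots> \<le> 2 ^ (M * a) * (1/2)" by (intro mult_left_mono kraft assms) auto
  also have "\<dots> < 2 ^ (M * a)" by simp
  finally show ?thesis .
qed

lemma weight_le_progress:
  assumes "M * a < strlen c"
  shows "weight T c \<le> progress a c / 2 ^ (K * a)"
proof -
  have "real (strlen c * K div M) \<le> real (strlen c * K) / real M" by (rule of_nat_div_le_of_nat)
  also have "\<dots> \<le> real (strlen c) / T"
    using T_le T_pos M_pos mult_left_mono[OF T_le, of "real (strlen c)"] by (simp add: field_simps)
  finally have "weight T c \<le> 2 powr (- real (strlen c * K div M))"
    unfolding weight_def by (intro powr_mono) auto
  also have "\<dots> = 1 / 2 ^ (strlen c * K div M)"
    by (simp add: powr_minus powr_realpow inverse_eq_divide)
  finally show ?thesis using assms by (simp add: progress_def)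
qed

text \<open>\<open>N\<close> is the largest integer strictly exceeded by some total. It exists since
  \<open>0\<close> is exceeded and all totals stay below \<open>2 ^ (M * a)\<close>.\<close>

lemma final_progress:
  obtains N where "N < 2 ^ (M * a)" "\<exists>k. reached a N k" "\<forall>k. total_progress a k \<le> real N + 1"
proof -
  define S where "S = {N. \<exists>k. reached a N k}"
  have S: "S \<subseteq> {..<2 ^ (M * a)}"
  proof
    fix N assume "N \<in> S"
    then obtain k where "real N < total_progress a k" by (auto simp: S_def reached_iff)
    also have "\<dots> < 2 ^ (M * a)"
      unfolding total_progress_def by (rule sum_progress_le[OF finite_A]) auto
    finally have "real N < real (2 ^ (M * a))" by simp
    then show "N \<in> {..<2 ^ (M * a)}" by (simp only: of_nat_less_iff lessThan_iff)
  qed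
  then have fin: "finite S" by (rule finite_subset) simp
  obtain k c where "A k c" using nonempty by blast
  then have "0 < total_progress a k"
    unfolding total_progress_def using finite_A progress_pos by (intro sum_pos) auto
  then have "0 \<in> S" by (auto simp: S_def reached_iff)
  then have Max: "Max S \<in> S" using fin by (intro Max_in) auto
  have "total_progress a k \<le> real (Max S) + 1" for k
  proof (rule ccontr)
    assume "\<not> ?thesis"
    then have "Suc (Max S) \<in> S" by (auto simp: S_def reached_iff intro!: exI[of _ k])
    then show False using Max_ge[OF fin] by fastforce
  qed
  then show ?thesis using that[of "Max S"] Max S by (auto simp: S_def)
qed

text \<open>Whatever is listed after stage \<open>k\<close> has total progress below
  \<open>1\<close>. A short string would contribute \<open>1\<close> by itself, and the weights of
  the long ones are bounded through their progress.\<close>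

lemma reached_imp:
  assumes N: "\<And>k. total_progress a k \<le> real N + 1" and k: "reached a N k"
  shows "\<theta> - 1 / 2 ^ (K * a) \<le> Z k T" and "\<exists>k. A k c \<Longrightarrow> strlen c \<le> M * a \<Longrightarrow> A k c"
proof -
  have less: "sum (progress a) F < 1" if F: "finite F" "F \<subseteq> {c. \<exists>k. A k c}" "F \<inter> {c. A k c} = {}" for F
  proof -
    have "eventually (\<lambda>k'. F \<union> {c. A k c} \<subseteq> {c. A k' c}) sequentially"
      using F finite_A by (intro eventually_A) auto
    then obtain k' where k': "F \<union> {c. A k c} \<subseteq> {c. A k' c}"
      by (auto simp: eventually_sequentially)
    have "sum (progress a) F + total_progress a k = sum (progress a) (F \<union> {c. A k c})"
      unfolding total_progress_def using F finite_A by (simp add: sum.union_disjoint)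
    also have "\<dots> \<le> total_progress a k'"
      unfolding total_progress_def using k' finite_A progress_pos
      by (intro sum_mono2) (auto intro: less_imp_le)
    finally show ?thesis using N[of k'] k unfolding reached_iff by linarith
  qed
  show short: "A k c" if "\<exists>k. A k c" "strlen c \<le> M * a" for c
  proof (rule ccontr)
    assume "\<not> A k c"
    then have "sum (progress a) {c} < 1" using that by (intro less) auto
    then show False using that by (simp add: progress_def)
  qed
  have "sum (weight T) F \<le> Z k T + 1 / 2 ^ (K * a)" if F: "finite F" "F \<subseteq> {c. \<exists>k. A k c}" for F
  proof -
    have "sum (weight T) F = sum (weight T) (F \<inter> {c. A k c}) + sum (weight T) (F - {c. A k c})"
      using F(1) by (rule sum.Int_Diff)
    also have "sum (weight T) (F \<inter> {c. A k c}) \<le> Z k T"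
      unfolding Z_def using finite_A by (intro sum_mono2) (auto simp: weight_nonneg)
    also have "sum (weight T) (F - {c. A k c}) \<le> (\<Sum>c\<in>F - {c. A k c}. progress a c / 2 ^ (K * a))"
    proof (intro sum_mono weight_le_progress)
      fix c assume "c \<in> F - {c. A k c}"
      then have "\<exists>k. A k c" "\<not> A k c" using F(2) by auto
      then show "M * a < strlen c" using short[of c] not_less by blast
    qed
    also have "\<dots> = sum (progress a) (F - {c. A k c}) / 2 ^ (K * a)" by (simp add: sum_divide_distrib)
    also have "\<dots> \<le> 1 / 2 ^ (K * a)"
    proof (rule divide_right_mono)
      have "sum (progress a) (F - {c. A k c}) < 1" using F by (intro less) auto
      then show "sum (progress a) (F - {c. A k c}) \<le> 1" by simp
    qed simp
    finally show ?thesis by simp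
  qed
  then have "\<theta> \<le> Z k T + 1 / 2 ^ (K * a)" by (rule has_sum_le_finite_sums[OF theta])
  then show "\<theta> - 1 / 2 ^ (K * a) \<le> Z k T" by simp
qed

text \<open>The range suffices: as \<open>T < 1\<close>, the first grid point above \<open>T\<close>
  is at most \<open>1\<close>. The value \<open>j = 0\<close> is excluded because it gives no
  positive argument for \<open>Z\<close>.\<close>

definition estimate :: "nat \<Rightarrow> nat \<Rightarrow> nat" where
  "estimate a k = bounded_least (Suc (2 ^ (K * a))) (\<lambda>j. 0 < j \<and> good (K * a) j k)"

lemma rec_env_estimate:
  assumes "rec_env F" "rec_env G"
  shows "rec_env (\<lambda>e. estimate (F e) (G e))"
proof (rule rec_env_comp2[OF _ assms])
  show "rec_env (\<lambda>e. estimate (e 0) (e (Suc 0)))"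
    unfolding estimate_def by (intro rec_env_intros dec_env_good)
qed

text \<open>The grid point just above \<open>T\<close> is good, which gives the upper bound. A good
  grid point far below \<open>T\<close> would contradict \<open>Z_gap\<close> for a fixed string
  \<open>c\<close>; \<open>a \<ge> strlen c\<close> ensures that \<open>c\<close> is listed by stage
  \<open>k\<close>.\<close>

lemma estimate_bounds:
  "\<exists>\<Delta> a0. \<forall>a\<ge>a0. \<forall>N k. (\<forall>k. total_progress a k \<le> real N + 1) \<longrightarrow> reached a N k \<longrightarrow> K * a \<le> k \<longrightarrow>
     estimate a k \<le> Suc (nat \<lfloor>2 ^ (K * a) * T\<rfloor>) \<and> nat \<lfloor>2 ^ (K * a) * T\<rfloor> \<le> estimate a k + \<Delta>"
proof -
  obtain k0 c where c: "A k0 c" using nonempty by blast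
  \<comment> \<open>Here \<open>20\<close> is the \<open>5\<close> from \<open>good_imp_Z_ge\<close>
    times the \<open>4\<close> from \<open>Z_gap\<close>.\<close>
  obtain \<Delta> :: nat where \<Delta>: "20 / weight T c \<le> real \<Delta>" using real_arch_simple by blast
  show ?thesis
  proof (rule exI[of _ \<Delta>], rule exI[of _ "strlen c"], intro allI impI)
    fix a N k
    assume a: "strlen c \<le> a" and N: "\<forall>k. total_progress a k \<le> real N + 1"
      and k: "reached a N k" "K * a \<le> k"
    define n where "n = K * a"
    define J where "J = nat \<lfloor>2 ^ n * T\<rfloor>"
    have J: "real J \<le> 2 ^ n * T" "2 ^ n * T < real J + 1"
      using T_pos by (simp_all add: J_def)
    have "2 ^ n * T < real (2 ^ n)" using T_less by simp
    with J have "real J < real (2 ^ n)" by linarith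
    then have J_less: "J < 2 ^ n" by (simp only: of_nat_less_iff)
    have Zk: "\<theta> - 1 / 2 ^ n \<le> Z k T" unfolding n_def using reached_imp(1)[OF N[rule_format] k(1)] .
    have "1 * a \<le> M * a" using M_pos by (intro mult_right_mono) auto
    then have "strlen c \<le> M * a" using a by linarith
    then have Ac: "A k c" using c by (intro reached_imp(2)[OF N[rule_format] k(1)]) auto
    have "T \<le> real (Suc J) / 2 ^ n" using J by (simp add: field_simps)
    then have g: "0 < Suc J \<and> good n (Suc J) k" using goodI[OF _ Zk] k(2) by (simp add: n_def)
    have est: "estimate a k = (LEAST j. 0 < j \<and> good n j k)"
      unfolding estimate_def n_def[symmetric] using g J_less
      by (intro bounded_least_eq) (blast intro: Suc_mono)
    define j where "j = estimate a k"
    have j: "0 < j" "good n j k"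
      using LeastI[of "\<lambda>j. 0 < j \<and> good n j k", OF g] by (simp_all add: j_def est)
    have "j \<le> Suc J" unfolding j_def est by (rule Least_le[of "\<lambda>j. 0 < j \<and> good n j k", OF g])
    moreover have "J \<le> j + \<Delta>"
    proof (cases "real j / 2 ^ n \<le> T")
      case True
      have "\<theta> - 5 / 2 ^ n < Z k (real j / 2 ^ n)" by (rule good_imp_Z_ge[OF j(2,1)])
      also have "\<dots> \<le> Z k T - weight T c * ((T - real j / 2 ^ n) / 4)"
        using j(1) True by (intro Z_gap Ac) auto
      also have "Z k T \<le> \<theta>" by (rule Z_le)
      finally have "weight T c * (T - real j / 2 ^ n) < 20 / 2 ^ n" by simp
      then have "T - real j / 2 ^ n < 20 / weight T c / 2 ^ n"
        using weight_pos[of T c] by (simp add: field_simps)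
      also have "\<dots> \<le> real \<Delta> / 2 ^ n" using \<Delta> by (intro divide_right_mono) auto
      finally have "T < (real j + real \<Delta>) / 2 ^ n" by (simp add: add_divide_distrib)
      then have "2 ^ n * T < real j + real \<Delta>" by (simp add: field_simps)
      with J show ?thesis by linarith
    next
      case False
      then have "2 ^ n * T < real j" by (simp add: field_simps)
      with J have "real J < real j" by linarith
      then show ?thesis by simp
    qed
    ultimately show "estimate a k \<le> Suc (nat \<lfloor>2 ^ (K * a) * T\<rfloor>) \<and>
        nat \<lfloor>2 ^ (K * a) * T\<rfloor> \<le> estimate a k + \<Delta>"
      by (simp add: j_def J_def n_def)
  qed
qed

lemma str_code_prefix_bits_diff:
  assumes "r \<le> n"
  shows "str_code (prefix_bits T (n - r)) = 2 ^ (n - r) + nat \<lfloor>2 ^ n * T\<rfloor> div 2 ^ r - 1"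
proof -
  have "\<lfloor>2 ^ (n - r) * T\<rfloor> = \<lfloor>2 ^ n * T / real_of_int (2 ^ r)\<rfloor>"
    using assms by (simp add: power_diff)
  also have "\<dots> = \<lfloor>2 ^ n * T\<rfloor> div 2 ^ r" by (rule floor_divide_real_eq_div) simp
  finally have "nat \<lfloor>2 ^ (n - r) * T\<rfloor> = nat \<lfloor>2 ^ n * T\<rfloor> div 2 ^ r"
    using T_pos by (simp add: nat_div_distrib nat_power_eq)
  then show ?thesis using str_code_prefix_bits[OF T_pos T_less, of "n - r"] by (metis diff_Suc_1)
qed

text \<open>A program states \<open>a\<close> in unary and \<open>N\<close> in \<open>M * a\<close>
  bits. The correction of the estimate and the number \<open>r\<close> of dropped bits have finitely
  many values, so each pair gets a machine of its own.\<close>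

lemma program_length:
  assumes U: "optimal_machine U"
  shows "\<exists>d a0. \<forall>a\<ge>a0. \<forall>r<K. r \<le> K * a \<longrightarrow>
    (\<exists>q. U q = Some (prefix_bits T (K * a - r)) \<and> length q \<le> a + M * a + d)"
proof -
  obtain \<Delta> a0 where est: "\<And>a N k. a0 \<le> a \<Longrightarrow> \<forall>k. total_progress a k \<le> real N + 1 \<Longrightarrow>
     reached a N k \<Longrightarrow> K * a \<le> k \<Longrightarrow>
     estimate a k \<le> Suc (nat \<lfloor>2 ^ (K * a) * T\<rfloor>) \<and> nat \<lfloor>2 ^ (K * a) * T\<rfloor> \<le> estimate a k + \<Delta>"
    using estimate_bounds by blast
  interpret unary_header M 0 .
  define R where "R a N k \<longleftrightarrow> reached a N k \<and> K * a \<le> k" for a N k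
  define h where "h r \<delta> a N k = 2 ^ (K * a - r) + (estimate a k + \<delta> - 1) div 2 ^ r - 1"
    for r \<delta> a N k :: nat
  have "dec_env (\<lambda>e. R (e (Suc (Suc 0))) (e (Suc 0)) (e 0))"
    unfolding R_def by (intro rec_env_intros dec_env_reached)
  moreover have "rec_env (\<lambda>e. h r \<delta> (e (Suc (Suc 0))) (e (Suc 0)) (e 0))" for r \<delta>
    unfolding h_def by (intro rec_env_intros rec_env_estimate)
  ultimately have "\<forall>r \<delta>. \<exists>d. \<forall>a N. N < 2 ^ (M * a + 0) \<longrightarrow> (\<exists>k. R a N k) \<longrightarrow>
    (\<exists>q. U q = Some (str_decode (h r \<delta> a N (LEAST k. R a N k))) \<and>
       length q \<le> a + 1 + (M * a + 0) + d)"
    using optimal_machine_upper_bound[OF U] by blast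
  then obtain d where d: "\<And>r \<delta> a N. N < 2 ^ (M * a + 0) \<Longrightarrow> \<exists>k. R a N k \<Longrightarrow>
    \<exists>q. U q = Some (str_decode (h r \<delta> a N (LEAST k. R a N k))) \<and>
       length q \<le> a + 1 + (M * a + 0) + d r \<delta>"
    by metis
  \<comment> \<open>A common bound for the constants of all these machines.\<close>
  define D where "D = (\<Sum>r<K. \<Sum>\<delta><\<Delta> + 2. d r \<delta>)"
  have D: "d r \<delta> \<le> D" if "r < K" "\<delta> < \<Delta> + 2" for r \<delta>
  proof -
    have "d r \<delta> \<le> (\<Sum>\<delta><\<Delta> + 2. d r \<delta>)" using that by (intro member_le_sum) auto
    also have "\<dots> \<le> D" unfolding D_def
      using that member_le_sum[of r "{..<K}" "\<lambda>r. \<Sum>\<delta><\<Delta> + 2. d r \<delta>"] by auto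
    finally show ?thesis .
  qed
  show ?thesis
  proof (rule exI[of _ "Suc D"], rule exI[of _ a0], intro allI impI)
    fix a r assume a: "a0 \<le> a" and r: "r < K" "r \<le> K * a"
    obtain N where N: "N < 2 ^ (M * a)" "\<exists>k. reached a N k" "\<forall>k. total_progress a k \<le> real N + 1"
      by (rule final_progress[of a])
    have "\<exists>k. R a N k"
    proof -
      obtain k where k: "reached a N k" using N(2) by blast
      \<comment> \<open>The stage is moved up to meet the extra demand \<open>K * a \<le> k\<close>
        in \<open>R\<close>.\<close>
      have "total_progress a k \<le> total_progress a (k + K * a)"
        unfolding total_progress_def using finite_A progress_pos
        by (intro sum_mono2) (auto intro: less_imp_le A_mono)
      with k have "R a N (k + K * a)" by (simp add: R_def reached_iff)
      then show ?thesis by blast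
    qed
    then have k: "R a N (LEAST k. R a N k)" by (rule LeastI_ex)
    define k where "k = (LEAST k. R a N k)"
    define J where "J = nat \<lfloor>2 ^ (K * a) * T\<rfloor>"
    have J: "estimate a k \<le> Suc J" "J \<le> estimate a k + \<Delta>"
      using est[OF a, of N k] N(3) k by (simp_all add: R_def J_def k_def)
    \<comment> \<open>The estimate can be as large as \<open>Suc J\<close>, so the correction is
      measured from there to stay a natural number; \<open>h\<close> subtracts the \<open>1\<close>
      again.\<close>
    define \<delta> where "\<delta> = Suc J - estimate a k"
    have \<delta>: "\<delta> < \<Delta> + 2" "estimate a k + \<delta> - 1 = J" using J by (simp_all add: \<delta>_def)
    have "h r \<delta> a N k = str_code (prefix_bits T (K * a - r))"
      unfolding h_def \<delta>(2) str_code_prefix_bits_diff[OF r(2)] J_def ..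
    then obtain q where "U q = Some (prefix_bits T (K * a - r))" "length q \<le> a + 1 + M * a + d r \<delta>"
      using d[of N a r \<delta>] N(1) k by (auto simp flip: k_def)
    then show "\<exists>q. U q = Some (prefix_bits T (K * a - r)) \<and> length q \<le> a + M * a + Suc D"
      using D[OF r(1) \<delta>(1)] by (intro exI[of _ q]) auto
  qed
qed

text \<open>For \<open>n\<close> rounded up to a multiple \<open>K * a\<close>, the program has
  about \<open>(M + 1) * a\<close> bits, that is \<open>(M + 1) / K\<close> per bit of
  \<open>T\<close>; the constants vanish in the quotient.\<close>

lemma eventually_Hc_le:
  assumes U: "optimal_machine U" and y: "(real M + 1) / real K < y"
  shows "eventually (\<lambda>n. ereal_of_enat (Hc U (prefix_bits T n)) / ereal (real n) \<le> ereal y) sequentially"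
proof -
  have K: "0 < K" using M_pos M_le by simp
  obtain d a0 where d: "\<And>a r. a0 \<le> a \<Longrightarrow> r < K \<Longrightarrow> r \<le> K * a \<Longrightarrow>
    \<exists>q. U q = Some (prefix_bits T (K * a - r)) \<and> length q \<le> a + M * a + d"
    using program_length[OF U] by blast
  define z where "z = (real M + 1) / real K"
  obtain n1 :: nat where n1: "(real M + 1 + real d) / (y - z) \<le> real n1" using real_arch_simple by blast
  show ?thesis
    using eventually_ge_at_top[of "K * a0"] eventually_ge_at_top[of n1] eventually_gt_at_top[of 0]
  proof eventually_elim
    case (elim n)
    \<comment> \<open>\<open>a\<close> is \<open>n / K\<close> rounded up, and \<open>r\<close> is
      the number of surplus bits to be dropped.\<close>
    define a where "a = Suc ((n - 1) div K)"
    define r where "r = K * a - n"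
    have div: "n - 1 = K * ((n - 1) div K) + (n - 1) mod K" by simp
    have md: "(n - 1) mod K < K" using K by simp
    have a: "n \<le> K * a" "K * a < n + K" using div md elim(3) unfolding a_def mult_Suc_right by linarith+
    have "K * a0 \<le> K * a" using elim(1) a by linarith
    then have "a0 \<le> a" using K by simp
    moreover have "r < K" "r \<le> K * a" "K * a - r = n" using a K by (auto simp: r_def)
    ultimately obtain q where q: "U q = Some (prefix_bits T n)" "length q \<le> a + M * a + d"
      using d[of a r] by auto
    have "Hc U (prefix_bits T n) \<le> enat (length q)"
      unfolding Hc_def using q(1) by (intro INF_lower) simp
    then have le: "ereal_of_enat (Hc U (prefix_bits T n)) \<le> ereal (real (length q))"
      by (metis ereal_of_enat_le_iff ereal_of_enat_simps(1))
    have "real K * real a \<le> real n + real K"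
      using a(2) by (metis less_imp_le of_nat_add of_nat_le_iff of_nat_mult)
    then have "real a \<le> real n / real K + 1" using K by (simp add: field_simps)
    then have "(real M + 1) * real a \<le> (real M + 1) * (real n / real K + 1)"
      by (intro mult_left_mono) auto
    moreover have "real (length q) \<le> real (a + M * a + d)" using q(2) by (simp only: of_nat_le_iff)
    ultimately have "real (length q) \<le> z * real n + (real M + 1 + real d)"
      by (simp add: z_def algebra_simps)
    also have "real M + 1 + real d \<le> (y - z) * real n"
    proof -
      have "(real M + 1 + real d) / (y - z) \<le> real n" using n1 elim(2) by linarith
      then show ?thesis using y by (simp add: z_def field_simps)
    qed
    finally have "real (length q) / real n \<le> y" using elim(3) by (simp add: field_simps)
    moreover have "ereal_of_enat (Hc U (prefix_bits T n)) / ereal (real n) \<le>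
        ereal (real (length q)) / ereal (real n)"
      using le elim(3) by (intro ereal_divide_right_mono) auto
    ultimately show ?case using elim(3) by (auto intro: order_trans)
  qed
qed

end

lemma (in enumerated_partition_function) compressible:
  assumes U: "optimal_machine U"
  shows "compressible U T T"
  unfolding compressible_def
proof (rule ereal_le_epsilon2)
  fix \<epsilon> :: real assume \<epsilon>: "0 < \<epsilon>"
  \<comment> \<open>Rounding \<open>K * T\<close> up and the unary header cost at most
    \<open>1\<close> each, so the rate is at most \<open>T + 2 / K < T + \<epsilon>\<close>.\<close>
  obtain K :: nat where K: "2 / \<epsilon> < real K" using reals_Archimedean2 by blast
  have "0 < 2 / \<epsilon>" using \<epsilon> by simp
  with K have K_pos: "0 < real K" by linarith
  define M where "M = Suc (nat \<lfloor>real K * T\<rfloor>)"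
  have nonneg: "0 \<le> real K * T" using T_pos by simp
  have fl: "real (nat \<lfloor>real K * T\<rfloor>) \<le> real K * T" "real K * T < real (nat \<lfloor>real K * T\<rfloor>) + 1"
    using nonneg by simp_all
  have "real K * T < real K" using T_less K_pos by simp
  with fl have "nat \<lfloor>real K * T\<rfloor> < K" by linarith
  moreover have "real K * T \<le> real M" using fl(2) unfolding M_def of_nat_Suc by linarith
  ultimately interpret rational_upper_bound A T \<theta> num_pos num_neg den K M
    by unfold_locales (auto simp: M_def)
  have "(real M + 1) / real K \<le> T + 2 / real K"
    using fl K_pos by (simp add: M_def field_simps)
  also have "\<dots> < T + \<epsilon>" using K K_pos \<epsilon> by (simp add: field_simps)
  finally have "eventually (\<lambda>n. ereal_of_enat (Hc U (prefix_bits T n)) / ereal (real n)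
      \<le> ereal (T + \<epsilon>)) sequentially"
    by (rule eventually_Hc_le[OF U])
  then show "limsup (\<lambda>n. ereal_of_enat (Hc U (prefix_bits T n)) / ereal (real n)) \<le> ereal T + ereal \<epsilon>"
    by (simp add: Limsup_bounded)
qed

lemma enumerated_partition_function_exists:
  assumes V: "optimal_machine V" and T: "0 < T" "T < 1" and comp: "computable_real (Theta V T)"
  obtains A num_pos num_neg den
  where "enumerated_partition_function A T (Theta V T) num_pos num_neg den"
    and "\<And>c. str_decode c \<in> compressible_strings V \<longleftrightarrow> (\<exists>k. A k c)"
proof -
  have V': "prefix_free_machine V" using V by (simp add: optimal_machine_def)
  obtain A where A: "dec_env (\<lambda>e. A (e 0) (e (Suc 0)))" "\<And>k c. A k c \<Longrightarrow> c < k"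
    "\<And>k k' c. A k c \<Longrightarrow> k \<le> k' \<Longrightarrow> A k' c"
    "\<And>c. str_decode c \<in> compressible_strings V \<longleftrightarrow> (\<exists>k. A k c)"
    using enumerate_compressible_strings[OF V'] by blast
  obtain num_pos num_neg den where nd: "total_recursive num_pos" "total_recursive num_neg"
    "total_recursive den" "\<forall>n\<ge>1. \<bar>Theta V T -
      (real (num_pos n) - real (num_neg n)) / real (den n + 1)\<bar> < 1 / real n"
    using comp unfolding computable_real_def by blast
  have kraft: "(\<Sum>c\<in>F. (1/2 :: real) ^ strlen c) \<le> 1/2" if "finite F" "F \<subseteq> {c. \<exists>k. A k c}" for F
  proof -
    have "str_decode ` F \<subseteq> compressible_strings V" using that(2) A(4) by auto
    then have "(\<Sum>s\<in>str_decode ` F. (1/2 :: real) ^ length s) \<le> 1/2"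
      using that(1) by (intro kraft_compressible_strings[OF V']) auto
    moreover have "inj_on str_decode F" by (metis inj_onI str_code_decode)
    ultimately show ?thesis by (simp add: sum.reindex)
  qed
  have "weight T summable_on {c. \<exists>k. A k c}"
  proof (rule nonneg_bounded_partial_sums_imp_summable_on)
    show "eventually (\<lambda>F. sum (weight T) F \<le> 1/2) (finite_subsets_at_top {c. \<exists>k. A k c})"
    proof (rule eventually_finite_subsets_at_top_weakI)
      fix F assume F: "finite F" "F \<subseteq> {c. \<exists>k. A k c}"
      \<comment> \<open>Since \<open>T < 1\<close>, the terms are dominated by those at
        \<open>1\<close>, to which Kraft's inequality applies.\<close>
      have "sum (weight T) F \<le> sum (weight 1) F" using T by (intro sum_mono weight_mono) auto
      also have "\<dots> \<le> 1/2" using kraft[OF F] by (simp add: weight_1)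
      finally show "sum (weight T) F \<le> 1/2" .
    qed
  qed (rule weight_nonneg)
  then have "(weight T has_sum infsum (weight T) {c. \<exists>k. A k c}) {c. \<exists>k. A k c}"
    by (rule has_sum_infsum)
  moreover have "infsum (weight T) {c. \<exists>k. A k c} = Theta V T"
  proof -
    have "bij_betw str_code (compressible_strings V) {c. \<exists>k. A k c}"
      by (rule bij_betwI[where g = str_decode]) (auto simp: A(4)[symmetric])
    then have "infsum (weight T) {c. \<exists>k. A k c} = infsum (\<lambda>s. weight T (str_code s)) (compressible_strings V)"
      by (rule infsum_reindex_bij_betw[symmetric])
    then show ?thesis by (simp add: Theta_def compressible_strings_def weight_def)
  qed
  moreover have "\<exists>k c. A k c"
  proof -
    obtain s where "s \<in> compressible_strings V" using compressible_strings_nonempty[OF V] by blast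
    then show ?thesis using A(4)[of "str_code s"] by auto
  qed
  ultimately have "enumerated_partition_function A T (Theta V T) num_pos num_neg den"
    using A nd kraft T by unfold_locales auto
  then show ?thesis using that A(4) by blast
qed

theorem theorem9:
  fixes U V :: "bool list \<Rightarrow> bool list option" and T :: real
  assumes "optimal_machine U" and "optimal_machine V"
    and "0 < T" and "T < 1"
    and "computable_real (Theta V T)"
  shows "weakly_Chaitin_random U T T \<and> compressible U T T"
proof -
  obtain A num_pos num_neg den
    where *: "enumerated_partition_function A T (Theta V T) num_pos num_neg den"
      and A: "\<And>c. str_decode c \<in> compressible_strings V \<longleftrightarrow> (\<exists>k. A k c)"
    using enumerated_partition_function_exists[OF assms(2-5)] by blast
  interpret enumerated_partition_function A T "Theta V T" num_pos num_neg den by (fact *)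
  show ?thesis using weakly_random[OF assms(1,2) A] compressible[OF assms(1)] by blast
qed

end
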